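(* Let $r\ge 1$ and $M>0$. Assume that either $s\ge 0$, or that $s<0$ and $\gamma\equiv -1/s>2/r$. Then there is a constant $K<\infty$ depending only on $r$, $M$ and $s$ such that for all $\epsilon>0$ $$\log N_{[\,]}(\epsilon,\mathcal{P}_{M,s}^{1/2},L_r)\le K\,\epsilon^{-1/2}.$$ In particular (taking $r=2$), if $s>-1$, then there is a constant $K'<\infty$ depending only on $M$ and $s$ such that for all $\epsilon>0$ $$\log N_{[\,]}(\epsilon,\mathcal{P}_{M,s},H)\le K'\,\epsilon^{-1/2}.$$
   Context: Let $\mathcal{C}$ be the set of all closed (i.e. upper semicontinuous), proper concave functions $\varphi:\mathbb{R}\to[-\infty,\infty)$. For $s\in\mathbb{R}$ let $h_s(y)=e^y$ if $s=0$, $h_s(y)=(-y)_+^{1/s}$ if $s<0$, $h_s(y)=y_+^{1/s}$ if $s>0$, where $x_+=\max(x,0)$ and $h_s(-\infty)=0$. With $\lambda$ Lebesgue measure, $\mathcal{P}_s=\{p=h_s\circ\varphi:\varphi\in\mathcal{C},\ \int p\,d\lambda=1\}$ is the class of $s$-concave densities on $\mathbb{R}$. For $0<M<\infty$, $$\mathcal{P}_{M,s}=\{p\in\mathcal{P}_s:\ \sup_{x\in\mathbb{R}}p(x)\le M,\ 1/M\le p(x)\text{ for all }|x|\le 1\},$$ and $\mathcal{P}_{M,s}^{1/2}=\{p^{1/2}:p\in\mathcal{P}_{M,s}\}$. $L_r(f,g)=(\int|f-g|^r\,d\lambda)^{1/r}$, and the Hellinger distance is given by $H^2(p,q)=\frac12\int(\sqrt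 p-\sqrt q)^2\,d\lambda$. For a class $\mathcal{F}$ and a distance $d$, $N_{[\,]}(\epsilon,\mathcal{F},d)$ is the $\epsilon$-bracketing number: the minimal number of brackets $[l,u]=\{f:l\le f\le u\}$ (with $l\le u$ functions, nonnegative when $d=H$, not necessarily in $\mathcal{F}$) with $d(l,u)\le\epsilon$ whose union contains $\mathcal{F}$. *)

theory Defs
  imports "HOL-Analysis.Analysis"
begin

definition proper_concave :: "(real \<Rightarrow> ereal) \<Rightarrow> bool" where
  "proper_concave \<phi> \<longleftrightarrow>
     (\<forall>x. \<phi> x < \<infinity>) \<and> (\<exists>x. -\<infinity> < \<phi> x) \<and>
     (\<forall>x y t. 0 < t \<and> t < 1 \<longrightarrow>
        ereal (1 - t) * \<phi> x + ereal t * \<phi> y \<le> \<phi> ((1 - t) * x + t * y))"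

definition upper_semicontinuous :: "(real \<Rightarrow> ereal) \<Rightarrow> bool" where
  "upper_semicontinuous \<phi> \<longleftrightarrow> (\<forall>c. closed {x. c \<le> \<phi> x})"

definition closed_proper_concave :: "(real \<Rightarrow> ereal) set" where
  "closed_proper_concave = {\<phi>. proper_concave \<phi> \<and> upper_semicontinuous \<phi>}"

(* For s < 0 the value 0 powr (1/s) has to be read as infinity, whereas 0 powr a = 0 in the
   library; hence the case distinction on 0 \<le> v and the codomain ennreal.  The value at
   +infinity is never used. *)
definition h :: "real \<Rightarrow> ereal \<Rightarrow> ennreal" where
  "h s y = (case y of
      ereal v \<Rightarrow>
        (if s = 0 then ennreal (exp v)
         else if s < 0 then (if 0 \<le> v then \<infinity> else ennreal ((- v) powr (1 / s)))
         else ennreal (max v 0 powr (1 / s)))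
    | PInfty \<Rightarrow> \<infinity>
    | MInfty \<Rightarrow> 0)"

definition s_concave_densities :: "real \<Rightarrow> (real \<Rightarrow> ennreal) set" where
  "s_concave_densities s =
     {p. \<exists>\<phi> \<in> closed_proper_concave. p = (\<lambda>x. h s (\<phi> x)) \<and> (\<integral>\<^sup>+x. p x \<partial>lborel) = 1}"

(* Densities bounded by M are finite everywhere, so this subclass is represented by
   nonnegative real-valued functions. *)
definition bounded_s_concave_densities :: "real \<Rightarrow> real \<Rightarrow> (real \<Rightarrow> real) set" where
  "bounded_s_concave_densities M s =
     {p. (\<forall>x. 0 \<le> p x) \<and> (\<lambda>x. ennreal (p x)) \<in> s_concave_densities s \<and>
         (SUP x. ennreal (p x)) \<le> ennreal M \<and>
         (\<forall>x. \<bar>x\<bar> \<le> 1 \<longrightarrow> 1 / M \<le> p x)}"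

definition sqrt_bounded_s_concave_densities :: "real \<Rightarrow> real \<Rightarrow> (real \<Rightarrow> real) set" where
  "sqrt_bounded_s_concave_densities M s =
     (\<lambda>p x. sqrt (p x)) ` bounded_s_concave_densities M s"

definition ennreal_powr :: "ennreal \<Rightarrow> real \<Rightarrow> ennreal" where
  "ennreal_powr a q = (if a = \<infinity> then \<infinity> else ennreal (enn2real a powr q))"

definition L_dist :: "real \<Rightarrow> (real \<Rightarrow> real) \<Rightarrow> (real \<Rightarrow> real) \<Rightarrow> ennreal" where
  "L_dist r f g = ennreal_powr (\<integral>\<^sup>+x. ennreal (\<bar>f x - g x\<bar> powr r) \<partial>lborel) (1 / r)"

definition hellinger_dist :: "(real \<Rightarrow> real) \<Rightarrow> (real \<Rightarrow> real) \<Rightarrow> ennreal" where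
  "hellinger_dist p q =
     ennreal_powr ((1 / 2) * (\<integral>\<^sup>+x. ennreal ((sqrt (p x) - sqrt (q x))\<^sup>2) \<partial>lborel)) (1 / 2)"

definition bracket :: "(real \<Rightarrow> real) \<Rightarrow> (real \<Rightarrow> real) \<Rightarrow> (real \<Rightarrow> real) set" where
  "bracket l u = {f. \<forall>x. l x \<le> f x \<and> f x \<le> u x}"

(* G is the set of functions admitted as bracket endpoints (all measurable functions for L_dist,
   the nonnegative ones for hellinger_dist).  The infimum over the empty set is infinity. *)
definition bracketing_number ::
  "(real \<Rightarrow> real) set \<Rightarrow> real \<Rightarrow> (real \<Rightarrow> real) set \<Rightarrow>
   ((real \<Rightarrow> real) \<Rightarrow> (real \<Rightarrow> real) \<Rightarrow> ennreal) \<Rightarrow> enat" where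
  "bracketing_number G \<epsilon> F d =
     Inf {enat (card B) | B. finite B \<and>
            (\<forall>(l, u) \<in> B. l \<in> G \<and> u \<in> G \<and> (\<forall>x. l x \<le> u x) \<and> d l u \<le> ennreal \<epsilon>) \<and>
            F \<subseteq> (\<Union>(l, u) \<in> B. bracket l u)}"

definition L_bracketing_number :: "real \<Rightarrow> real \<Rightarrow> (real \<Rightarrow> real) set \<Rightarrow> enat" where
  "L_bracketing_number r \<epsilon> F = bracketing_number (borel_measurable lborel) \<epsilon> F (L_dist r)"

definition hellinger_bracketing_number :: "real \<Rightarrow> (real \<Rightarrow> real) set \<Rightarrow> enat" where
  "hellinger_bracketing_number \<epsilon> F =
     bracketing_number {f \<in> borel_measurable lborel. \<forall>x. 0 \<le> f x} \<epsilon> F hellinger_dist"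

(* Natural logarithm with log 0 = -infinity (the class is empty when M is too small). *)
definition log_enat :: "enat \<Rightarrow> ereal" where
  "log_enat n = (case n of enat k \<Rightarrow> (if k = 0 then -\<infinity> else ereal (ln (real k))) | \<infinity> \<Rightarrow> \<infinity>)"

end

theory Submission
  imports Defs
begin

text \<open>
  A square root of an \<open>s\<close>-concave density has the form \<open>g powr (- \<alpha>)\<close> with \<open>g\<close> convex and
  \<open>\<alpha> r > 1\<close>: for \<open>s < 0\<close> take \<open>\<alpha> = - 1 / (2 s)\<close>, while for \<open>s \<ge> 0\<close> the density is log-concave
  and any \<open>\<alpha>\<close> will do. The lower bound on \<open>[-1, 1]\<close> and the total mass give the envelope
  \<open>A * max 1 \<bar>x\<bar> powr (- \<alpha>)\<close>, whose \<open>r\<close>-th power is integrable.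

  Entropy is bounded by three self-similar recursions, each of which splits an interval and glues
  brackets of the two parts. For Lipschitz convex functions in the uniform norm, one bisects the
  interval and records the value at the midpoint. A bounded monotone \<open>g powr (- \<alpha>)\<close> is either
  comparable to its bound on the first half, so that \<open>g\<close> is Lipschitz on the first quarter, or it
  is small on the second half; this takes care of vertical slopes and of the unknown support, and
  a unimodal function is monotone on one of the two halves. The tails are cut dyadically.
\<close>

section \<open>Finite families of brackets\<close>

text \<open>A tolerance fixed in advance cannot be divided sensibly among pieces of very different
  sizes. Each piece is therefore charged according to its own size \<open>Y\<close>, with one
  cut-off \<open>Z\<close> shared by all: the r-th power of its error is at most a constant times
  \<open>sqrt (Z * Y)\<close>, and the logarithm of the number of brackets at most a constant times
  \<open>(Y / Z) powr (1 / (4 * r))\<close>. Both are positive powers of \<open>Y\<close>, so pieces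
  whose sizes shrink by a fixed ratio contribute geometric series and no logarithmic factor appears.
  Equating the error with \<open>\<epsilon> powr r\<close> makes \<open>Y / Z\<close> proportional
  to \<open>\<epsilon> powr (- 2 * r)\<close>, whence the exponent \<open>- 1 / 2\<close>. The
  obstacle is that plain bisection makes both sums grow: two halves of equal height have sizes
  \<open>Y / 2\<close>, and twice \<open>sqrt (1 / 2)\<close> exceeds one. A split is affordable
  only if the second part is much lower than the first, or if just one part is passed on and the
  other is settled at once. Every case distinction below is made to reach one of these two
  situations.\<close>

definition encloses :: "real set \<Rightarrow> (real \<Rightarrow> real) \<times> (real \<Rightarrow> real) \<Rightarrow> (real \<Rightarrow> real) \<Rightarrow> bool" where
  "encloses I b f \<longleftrightarrow> (\<forall>x\<in>I. fst b x \<le> f x \<and> f x \<le> snd b x)"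

text \<open>Brackets are functions on the whole line but have to enclose only on \<open>I\<close>,
  so that families for adjacent intervals can be combined. The bound \<open>N\<close> is real
  because bounds such as \<open>exp (K * X)\<close> get multiplied and added.\<close>

definition covered ::
  "((real \<Rightarrow> real) \<times> (real \<Rightarrow> real) \<Rightarrow> bool) \<Rightarrow> real set \<Rightarrow> real \<Rightarrow> (real \<Rightarrow> real) set \<Rightarrow> bool" where
  "covered Q I N F \<longleftrightarrow>
     (\<exists>B. finite B \<and> real (card B) \<le> N \<and> (\<forall>b\<in>B. Q b) \<and> (\<forall>f\<in>F. \<exists>b\<in>B. encloses I b f))"

definition glue ::
  "real \<Rightarrow> (real \<Rightarrow> real) \<times> (real \<Rightarrow> real) \<Rightarrow> (real \<Rightarrow> real) \<times> (real \<Rightarrow> real) \<Rightarrow>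
   (real \<Rightarrow> real) \<times> (real \<Rightarrow> real)" where
  "glue m b c = ((\<lambda>x. if x \<le> m then fst b x else fst c x), (\<lambda>x. if x \<le> m then snd b x else snd c x))"

lemma covered_mono:
  assumes "covered Q I N F" "N \<le> N'" "F' \<subseteq> F" "\<And>b. Q b \<Longrightarrow> Q' b"
  shows "covered Q' I N' F'"
  using assms unfolding covered_def by (meson order_trans subsetD)

lemma covered_single:
  assumes "Q b" "\<And>f. f \<in> F \<Longrightarrow> encloses I b f" "1 \<le> N"
  shows "covered Q I N F"
  unfolding covered_def using assms by (intro exI[of _ "{b}"]) auto

text \<open>Transports a family along an operation on functions, given by its effect
  \<open>T\<close> on brackets: adding an affine function, taking negative powers (which swaps the
  two ends), reflection and squaring.\<close>

lemma covered_map: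
  assumes "covered Q I N F" "\<And>b. Q b \<Longrightarrow> Q' (T b)"
    "\<And>f'. f' \<in> F' \<Longrightarrow> \<exists>f\<in>F. \<forall>b. Q b \<longrightarrow> encloses I b f \<longrightarrow> encloses I' (T b) f'"
  shows "covered Q' I' N F'"
proof -
  obtain B where B: "finite B" "real (card B) \<le> N" "\<forall>b\<in>B. Q b" "\<forall>f\<in>F. \<exists>b\<in>B. encloses I b f"
    using assms(1) unfolding covered_def by blast
  have "real (card (T ` B)) \<le> N"
    using card_image_le[OF B(1), of T] B(2) by linarith
  moreover have "\<exists>b\<in>T ` B. encloses I' b f'" if "f' \<in> F'" for f'
    using assms(3)[OF that] B(3,4) by blast
  ultimately show ?thesis
    unfolding covered_def using B assms(2) by (intro exI[of _ "T ` B"]) auto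
qed

lemma covered_UN:
  assumes "finite J" "\<And>j. j \<in> J \<Longrightarrow> covered Q I N (F j)"
  shows "covered Q I (real (card J) * N) (\<Union>j\<in>J. F j)"
proof -
  have "\<forall>j\<in>J. \<exists>B. finite B \<and> real (card B) \<le> N \<and> (\<forall>b\<in>B. Q b) \<and> (\<forall>f\<in>F j. \<exists>b\<in>B. encloses I b f)"
    using assms(2) unfolding covered_def by blast
  then obtain B where B: "\<forall>j\<in>J. finite (B j) \<and> real (card (B j)) \<le> N \<and> (\<forall>b\<in>B j. Q b) \<and>
      (\<forall>f\<in>F j. \<exists>b\<in>B j. encloses I b f)"
    by (metis (no_types))
  have "real (card (\<Union>j\<in>J. B j)) \<le> (\<Sum>j\<in>J. real (card (B j)))"
    using card_UN_le[OF assms(1), of B] by (metis of_nat_mono of_nat_sum)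
  also have "\<dots> \<le> (\<Sum>j\<in>J. N)"
    using B by (intro sum_mono) auto
  finally have "real (card (\<Union>j\<in>J. B j)) \<le> real (card J) * N" by simp
  moreover have "finite (\<Union>j\<in>J. B j)" using assms(1) B by (intro finite_UN_I) blast+
  moreover have "\<forall>b\<in>\<Union>j\<in>J. B j. Q b" using B by blast
  moreover have "\<forall>f\<in>\<Union>j\<in>J. F j. \<exists>b\<in>\<Union>j\<in>J. B j. encloses I b f"
  proof
    fix f assume "f \<in> (\<Union>j\<in>J. F j)"
    then obtain j where j: "j \<in> J" "f \<in> F j" by (rule UN_E)
    then obtain b where "b \<in> B j" "encloses I b f" using B by meson
    then show "\<exists>b\<in>\<Union>j\<in>J. B j. encloses I b f" using j(1) by (intro bexI[of _ b] UN_I)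
  qed
  ultimately show ?thesis unfolding covered_def by (intro exI conjI)
qed

lemma covered_Un:
  assumes "covered Q I N F" "covered Q I N' F'"
  shows "covered Q I (N + N') (F \<union> F')"
proof -
  obtain B where B: "finite B" "real (card B) \<le> N" "\<forall>b\<in>B. Q b" "\<forall>f\<in>F. \<exists>b\<in>B. encloses I b f"
    using assms(1) unfolding covered_def by blast
  obtain B' where B': "finite B'" "real (card B') \<le> N'" "\<forall>b\<in>B'. Q b" "\<forall>f\<in>F'. \<exists>b\<in>B'. encloses I b f"
    using assms(2) unfolding covered_def by blast
  have "real (card (B \<union> B')) \<le> N + N'"
    using card_Un_le[of B B'] B(2) B'(2) by linarith
  then show ?thesis
    unfolding covered_def using B B' by (intro exI[of _ "B \<union> B'"]) blast
qed

text \<open>Each bracket for the part up to \<open>m\<close> is paired with each bracket for the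
  part beyond it, so the counts multiply and their logarithms add.\<close>

lemma covered_glue:
  assumes "covered Q1 I1 N1 F" "covered Q2 I2 N2 F"
    "\<And>b c. Q1 b \<Longrightarrow> Q2 c \<Longrightarrow> Q (glue m b c)"
    "I \<inter> {..m} \<subseteq> I1" "I \<inter> {m<..} \<subseteq> I2"
  shows "covered Q I (N1 * N2) F"
proof -
  obtain B where B: "finite B" "real (card B) \<le> N1" "\<forall>b\<in>B. Q1 b" "\<forall>f\<in>F. \<exists>b\<in>B. encloses I1 b f"
    using assms(1) unfolding covered_def by blast
  obtain C where C: "finite C" "real (card C) \<le> N2" "\<forall>b\<in>C. Q2 b" "\<forall>f\<in>F. \<exists>b\<in>C. encloses I2 b f"
    using assms(2) unfolding covered_def by blast
  let ?D = "(\<lambda>(b, c). glue m b c) ` (B \<times> C)"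
  have "card ?D \<le> card B * card C"
    using card_image_le[of "B \<times> C"] B(1) C(1) by (metis card_cartesian_product finite_cartesian_product)
  then have "real (card ?D) \<le> real (card B) * real (card C)"
    by (metis of_nat_le_iff of_nat_mult)
  also have "\<dots> \<le> N1 * N2"
    using B(2) C(2) by (intro mult_mono) auto
  finally have card: "real (card ?D) \<le> N1 * N2" .
  have "\<exists>d\<in>?D. encloses I d f" if f: "f \<in> F" for f
  proof -
    obtain b c where bc: "b \<in> B" "encloses I1 b f" "c \<in> C" "encloses I2 c f"
      using B(4) C(4) f by blast
    have "encloses I (glue m b c) f"
      using bc assms(4,5) unfolding encloses_def glue_def
      by (auto simp: subset_iff not_le)
    then show ?thesis using bc by force
  qed
  then show ?thesis
    unfolding covered_def using card B C assms(3)
    by (intro exI[of _ ?D]) auto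
qed

section \<open>Lipschitz convex functions in the uniform norm\<close>

text \<open>Order and width are demanded at every real \<open>x\<close>, not just where functions
  are enclosed: glued brackets then remain ordered everywhere, as \<open>bracketing_number\<close>
  requires.\<close>

definition sup_bracket :: "real \<Rightarrow> (real \<Rightarrow> real) \<times> (real \<Rightarrow> real) \<Rightarrow> bool" where
  "sup_bracket w b \<longleftrightarrow> fst b \<in> borel_measurable borel \<and> snd b \<in> borel_measurable borel \<and>
     (\<forall>x. fst b x \<le> snd b x \<and> snd b x \<le> fst b x + w)"

lemma sup_bracket_glue: "sup_bracket w b \<Longrightarrow> sup_bracket w c \<Longrightarrow> sup_bracket w (glue m b c)"
  unfolding sup_bracket_def glue_def by auto

text \<open>
  Convex functions on \<open>[a,b]\<close> after normalisation by the precision. The parameter \<open>v\<close> bounds the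
  length of the interval times the total change of slope: it controls the deviation from the
  chord, it is invariant under adding affine functions, and over the two halves of an interval
  it adds up to at most \<open>v / 2\<close>.
\<close>

definition tame :: "real \<Rightarrow> real \<Rightarrow> real \<Rightarrow> (real \<Rightarrow> real) set" where
  "tame a b v = {g. convex_on {a..b} g \<and> \<bar>g a\<bar> \<le> 1 \<and> \<bar>g b\<bar> \<le> 1 \<and>
     (\<exists>p q. (q - p) * (b - a) \<le> v \<and>
        (\<forall>x\<in>{a..b}. g a + p * (x - a) \<le> g x \<and> g b - q * (b - x) \<le> g x))}"

text \<open>Above, the chord is a bound by convexity. Below, the support lines at the two ends are
  averaged with the weights \<open>1 - t\<close> and \<open>t\<close>, which gives the chord minus
  \<open>t * (1 - t) * ((q - p) * (b - a))\<close>.\<close>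

lemma tame_bounds:
  assumes "g \<in> tame a b v" "a < b" "x \<in> {a..b}"
  shows "g x \<le> 1" "- 1 - v \<le> g x"
proof -
  obtain p q where g0: "convex_on {a..b} g" "\<bar>g a\<bar> \<le> 1" "\<bar>g b\<bar> \<le> 1" "(q - p) * (b - a) \<le> v"
      "\<And>x. x \<in> {a..b} \<Longrightarrow> g a + p * (x - a) \<le> g x \<and> g b - q * (b - x) \<le> g x"
    using assms(1) unfolding tame_def by blast
  note g = g0(1-4) g0(5)[OF assms(3), THEN conjunct1] g0(5)[OF assms(3), THEN conjunct2]
    g0(5)[of b, THEN conjunct1] g0(5)[of a, THEN conjunct2]
  define t where "t = (x - a) / (b - a)"
  have "t * (b - a) = x - a" using assms by (simp add: t_def)
  then have t3: "x = (1 - t) * a + t * b" by (simp add: algebra_simps)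
  have t12: "0 \<le> t" "t \<le> 1" using assms by (auto simp: t_def)
  note t = t12 t3
  have "g x \<le> (1 - t) * g a + t * g b"
    using convex_onD[OF g(1) t12, of a b] assms(2) unfolding t3[symmetric] real_scaleR_def by auto
  also have "\<dots> \<le> (1 - t) * 1 + t * 1"
    using g(2,3) t12 by (intro add_mono mult_left_mono) auto
  finally show "g x \<le> 1" by simp
  \<comment> \<open>Each support line, tested at the opposite end, shows that the secant slope lies
    between \<open>p\<close> and \<open>q\<close>.\<close>
  have "0 \<le> (q - p) * (b - a)" using g(7,8) assms(2) by (simp add: algebra_simps)
  then have qp: "0 \<le> q - p" using assms(2) by (simp add: zero_le_mult_iff)
  have xa: "x - a = t * (b - a)" "b - x = (1 - t) * (b - a)"
    unfolding \<open>t * (b - a) = x - a\<close>[symmetric] using \<open>t * (b - a) = x - a\<close> by (simp_all add: algebra_simps)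
  have "(1 - t) * (g a + p * (x - a)) + t * (g b - q * (b - x)) \<le> (1 - t) * g x + t * g x"
    using g t12 by (intro add_mono mult_left_mono) auto
  moreover have "(1 - t) * (g a + p * (x - a)) + t * (g b - q * (b - x)) =
      (1 - t) * g a + t * g b - t * (1 - t) * ((q - p) * (b - a))"
    unfolding xa by (simp add: algebra_simps)
  moreover have "t * (1 - t) * ((q - p) * (b - a)) \<le> 1 * v"
    using t12 g(4) \<open>0 \<le> (q - p) * (b - a)\<close> by (intro mult_mono) (auto simp: mult_le_one)
  moreover have "(1 - t) * (- 1) + t * (- 1) \<le> (1 - t) * g a + t * g b"
    using g(2,3) t12 by (intro add_mono mult_left_mono) auto
  ultimately show "- 1 - v \<le> g x" by (simp add: algebra_simps)
qed

text \<open>A supporting slope is guaranteed only at interior points; at an end of the interval the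
  slope may be infinite, which is why \<open>tame\<close> postulates \<open>p\<close> and
  \<open>q\<close> explicitly.\<close>

lemma convex_subgradient:
  fixes g :: "real \<Rightarrow> real"
  assumes "convex_on {a..b} g" "a < m" "m < b"
  obtains \<sigma> where "\<And>x. x \<in> {a..b} \<Longrightarrow> g m + \<sigma> * (x - m) \<le> g x"
  by (rule that, rule convex_le_Inf_differential[OF assms(1)]) (use assms in \<open>auto simp: interior_atLeastAtMost_real\<close>)

lemma convex_on_affine:
  assumes "convex S"
  shows "convex_on S (\<lambda>x::real. c * x + d)"
proof (rule convex_onI)
  fix t x y :: real
  show "c * ((1 - t) *\<^sub>R x + t *\<^sub>R y) + d \<le> (1 - t) * (c * x + d) + t * (c * y + d)"
    by (simp add: algebra_simps)
qed (rule assms)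

lemma convex_on_diff_affine:
  fixes g :: "real \<Rightarrow> real"
  assumes "convex_on S g"
  shows "convex_on S (\<lambda>x. g x - (c * x + d))"
  using convex_on_add[OF assms convex_on_affine[OF convex_on_imp_convex[OF assms], of "- c" "- d"]]
  by (simp add: algebra_simps)

text \<open>
  Halving an interval replaces \<open>n\<close> by \<open>n1\<close>, \<open>n2\<close> with \<open>n1 + n2\<close> about \<open>n / 2\<close>, and
  \<open>sqrt n1 + sqrt n2 \<le> sqrt n\<close> is critical when \<open>n1 = n2\<close>. The lower-order term makes room
  for the logarithmic cost of the choices made at each step.
\<close>

definition potential :: "nat \<Rightarrow> real" where
  "potential n = 100 * (sqrt (real n + 1) - sqrt (sqrt (real n + 1)))"

lemma potential_nonneg: "0 \<le> potential n"
proof -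
  define y where "y = sqrt (real n + 1)"
  have y: "1 \<le> y" unfolding y_def by simp
  then have "y * 1 \<le> y * y" by (intro mult_left_mono) auto
  then have "sqrt y \<le> y" using y by (intro real_le_lsqrt) (auto simp: power2_eq_square)
  then show ?thesis unfolding potential_def y_def by (simp add: add.commute)
qed

text \<open>In terms of the fourth roots \<open>u\<close>, \<open>a\<close>, \<open>b\<close> of
  \<open>n + 1\<close>, \<open>n1 + 1\<close>, \<open>n2 + 1\<close>, the potentials are
  \<open>100 * (u^2 - u)\<close> and so on, and \<open>gain\<close> leaves \<open>u / 5\<close> to
  spare. If \<open>a^2 + b^2\<close> is well below \<open>u^2\<close>, the quadratic terms alone
  provide this. Otherwise the split is nearly balanced, \<open>a + b\<close> exceeds
  \<open>u\<close> by a fixed factor, and the gain comes from the linear terms. The threshold is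
  \<open>20 ^ 4\<close>, which makes \<open>u\<close> at least 20.\<close>

lemma potential_step:
  fixes n n1 n2 :: nat
  assumes n: "160000 \<le> n" and le: "2 * (n1 + n2) \<le> n + 3"
  shows "ln ((real n + 4) * (real n + 1)\<^sup>2) + (potential n1 + potential n2) \<le> potential n"
proof -
  define u where "u = sqrt (sqrt (real n + 1))"
  define a where "a = sqrt (sqrt (real n1 + 1))"
  define b where "b = sqrt (sqrt (real n2 + 1))"
  define q where "q = a\<^sup>2 + b\<^sup>2"
  have u2: "u\<^sup>2 = sqrt (real n + 1)" and a2: "a\<^sup>2 = sqrt (real n1 + 1)" and b2: "b\<^sup>2 = sqrt (real n2 + 1)"
    unfolding u_def a_def b_def by simp_all
  have p4: "z ^ 4 = (z\<^sup>2)\<^sup>2" for z :: real by (simp flip: power_mult)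
  have u4: "u ^ 4 = real n + 1" and a4: "a ^ 4 = real n1 + 1" and b4: "b ^ 4 = real n2 + 1"
    unfolding p4 u2 a2 b2 by simp_all
  have "20 ^ 4 \<le> u ^ 4" unfolding u4 using n by simp
  then have u20: "20 \<le> u" by (subst (asm) power_mono_iff) (auto simp: u_def)
  have a0: "0 \<le> a" "0 \<le> b" by (auto simp: a_def b_def)
  have T: "a ^ 4 + b ^ 4 \<le> (u ^ 4 + 6) / 2"
    unfolding a4 b4 u4 using le by (simp add: field_simps)
  have u4b: "160000 \<le> u ^ 4" unfolding u4 using n by simp
  have gain: "q - (a + b) \<le> u\<^sup>2 - u - (1/5) * u"
  proof (cases "q \<le> (9/10) * u\<^sup>2")
    case True
    have "20 * u \<le> u\<^sup>2" using u20 by (simp add: power2_eq_square)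
    then show ?thesis using True a0 u20 by linarith
  next
    case False
    have "((9/10) * u\<^sup>2)\<^sup>2 \<le> q\<^sup>2" using False by (intro power_mono) auto
    moreover have "((9/10) * u\<^sup>2)\<^sup>2 = (81/100) * u ^ 4" unfolding p4 power_mult_distrib by (simp add: power2_eq_square)
    ultimately have q1: "(81/100) * u ^ 4 \<le> q\<^sup>2" by simp
    have q2: "q\<^sup>2 = a ^ 4 + b ^ 4 + 2 * (a * b)\<^sup>2"
      unfolding q_def by (simp add: power2_eq_square power4_eq_xxxx algebra_simps)
    \<comment> \<open>Near the critical value of \<open>q\<close> the product \<open>a * b\<close>
      cannot be small, since the sum of the fourth powers is only about
      \<open>u ^ 4 / 2\<close>.\<close>
    have "(3/10) * u ^ 4 \<le> 2 * (a * b)\<^sup>2" using q1 q2 T u4b by (simp add: field_simps)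
    moreover have "((38/100) * u\<^sup>2)\<^sup>2 = (1444/10000) * u ^ 4" unfolding p4 power_mult_distrib by (simp add: power2_eq_square)
    ultimately have "((38/100) * u\<^sup>2)\<^sup>2 \<le> (a * b)\<^sup>2" using u4b by linarith
    then have ab: "(38/100) * u\<^sup>2 \<le> a * b" by (rule power2_le_imp_le) (use a0 in auto)
    have "(a + b)\<^sup>2 = q + 2 * (a * b)" unfolding q_def by (simp add: power2_eq_square algebra_simps)
    moreover have "((128/100) * u)\<^sup>2 = (16384/10000) * u\<^sup>2" unfolding power_mult_distrib by (simp add: power2_eq_square)
    moreover have "0 \<le> u\<^sup>2" by simp
    ultimately have "((128/100) * u)\<^sup>2 \<le> (a + b)\<^sup>2" using ab False by linarith
    then have s: "(128/100) * u \<le> a + b" by (rule power2_le_imp_le) (use a0 in auto)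
    have "0 \<le> (a\<^sup>2 - b\<^sup>2)\<^sup>2" by simp
    then have "q\<^sup>2 \<le> 2 * (a ^ 4 + b ^ 4)"
      unfolding q_def by (simp add: power2_eq_square power4_eq_xxxx algebra_simps)
    also have "\<dots> \<le> (u\<^sup>2 + 1)\<^sup>2"
    proof -
      have "20 * 20 \<le> u * u" using u20 by (intro mult_mono) auto
      moreover have "(u\<^sup>2 + 1)\<^sup>2 = u ^ 4 + 2 * (u * u) + 1"
        by (simp add: power2_eq_square power4_eq_xxxx algebra_simps)
      ultimately show ?thesis using T by simp
    qed
    finally have "q \<le> u\<^sup>2 + 1" by (rule power2_le_imp_le) auto
    then show ?thesis using s u20 by linarith
  qed
  \<comment> \<open>The logarithm of the number of choices is below \<open>12 * u\<close>, by the
    crude bound \<open>ln u \<le> u - 1\<close>; the factor 100 in \<open>potential\<close> turns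
    the spare \<open>u / 5\<close> into \<open>20 * u\<close>.\<close>
  have "(real n + 4) * (real n + 1)\<^sup>2 \<le> (2 * u ^ 4) * (2 * u ^ 4)\<^sup>2"
    unfolding u4 using n by (intro mult_mono power_mono) auto
  also have "\<dots> = (2 * u ^ 4) ^ 3" by (simp only: power2_eq_square power3_eq_cube mult.assoc)
  finally have "ln ((real n + 4) * (real n + 1)\<^sup>2) \<le> ln ((2 * u ^ 4) ^ 3)"
    using u20 by (intro ln_mono) (auto intro!: mult_pos_pos zero_less_power add_nonneg_pos)
  also have "\<dots> = 3 * (ln 2 + 4 * ln u)"
    using u20 by (simp only: ln_realpow zero_less_mult_iff zero_less_power) (simp add: ln_mult ln_realpow)
  also have "\<dots> \<le> 3 * (1 + 4 * (u - 1))"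
    using u20 ln_le_minus_one[of u] ln_2_less_1 by (intro mult_left_mono add_mono) auto
  also have "\<dots> \<le> 100 * ((1/5) * u)" using u20 by simp
  finally have L: "ln ((real n + 4) * (real n + 1)\<^sup>2) \<le> 100 * ((1/5) * u)" .
  have "potential n1 = 100 * (a\<^sup>2 - a)" "potential n2 = 100 * (b\<^sup>2 - b)" "potential n = 100 * (u\<^sup>2 - u)"
    unfolding potential_def a_def b_def u_def by simp_all
  then show ?thesis using L gain unfolding q_def by (simp add: field_simps)
qed

lemma sup_bracket_add:
  assumes "sup_bracket w b" "e \<in> borel_measurable borel"
  shows "sup_bracket w (\<lambda>x. fst b x + e x, \<lambda>x. snd b x + e x)"
  using assms unfolding sup_bracket_def by auto

lemma covered_shift:
  assumes "covered (sup_bracket w) I N F" "e \<in> borel_measurable borel" "\<And>g. g \<in> F' \<Longrightarrow> (\<lambda>x. g x - e x) \<in> F"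
  shows "covered (sup_bracket w) I N F'"
proof (rule covered_map[OF assms(1), where T = "\<lambda>b. (\<lambda>x. fst b x + e x, \<lambda>x. snd b x + e x)"])
  fix g assume "g \<in> F'"
  then show "\<exists>f\<in>F. \<forall>b. sup_bracket w b \<longrightarrow> encloses I b f \<longrightarrow>
      encloses I (\<lambda>x. fst b x + e x, \<lambda>x. snd b x + e x) g"
    by (intro bexI[OF _ assms(3)]) (auto simp: encloses_def algebra_simps)
qed (use sup_bracket_add assms(2) in auto)

lemma tameI:
  assumes "convex_on {a..b} g" "\<bar>g a\<bar> \<le> 1" "\<bar>g b\<bar> \<le> 1" "(q - p) * (b - a) \<le> v"
    "\<And>x. x \<in> {a..b} \<Longrightarrow> g a + p * (x - a) \<le> g x"
    "\<And>x. x \<in> {a..b} \<Longrightarrow> g b - q * (b - x) \<le> g x"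
  shows "g \<in> tame a b v"
  using assms unfolding tame_def by blast

text \<open>A supporting slope \<open>\<sigma>\<close> at the midpoint divides the slope range
  \<open>[p, q]\<close> into \<open>[p, \<sigma>]\<close> and \<open>[\<sigma>, q]\<close>, and both
  parts are multiplied by half the length; this yields the sum \<open>n / 2\<close>. The integer
  \<open>k\<close> rounds \<open>g m\<close>, and the subtracted affine functions vanish at the
  outer ends and equal \<open>k\<close> at \<open>m\<close>, so all end values stay within
  \<open>[-1, 1]\<close>. Rounding up to \<open>n1\<close> and \<open>n2\<close> adds less than 1
  each, whence the \<open>+ 3\<close>.\<close>

lemma tame_split:
  assumes g: "g \<in> tame a b (real n)" and ab: "a < b" and n: "4 \<le> n" and m: "m = (a + b) / 2"
  obtains k :: int and n1 n2 :: nat where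
    "k \<in> {- int n - 2..1}" "n1 \<le> n" "n2 \<le> n" "2 * (n1 + n2) \<le> n + 3"
    "(\<lambda>x. g x - (k / (m - a) * x - k / (m - a) * a)) \<in> tame a m (real n1)"
    "(\<lambda>x. g x - (- k / (m - a) * x + k / (m - a) * b)) \<in> tame m b (real n2)"
proof -
  obtain p q where g0: "convex_on {a..b} g" "\<bar>g a\<bar> \<le> 1" "\<bar>g b\<bar> \<le> 1" "(q - p) * (b - a) \<le> real n"
      "\<And>x. x \<in> {a..b} \<Longrightarrow> g a + p * (x - a) \<le> g x"
      "\<And>x. x \<in> {a..b} \<Longrightarrow> g b - q * (b - x) \<le> g x"
    using g unfolding tame_def by blast
  define d where "d = m - a"
  have am: "a < m" "m < b" "b = m + d" "a = m - d" "0 < d" "b - m = d"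
    using ab by (auto simp: m d_def field_simps)
  obtain \<sigma> where \<sigma>: "\<And>x. x \<in> {a..b} \<Longrightarrow> g m + \<sigma> * (x - m) \<le> g x"
    using convex_subgradient[OF g0(1) am(1,2)] by blast
  define k where "k = \<lfloor>g m\<rfloor>"
  have gm: "g m \<le> 1" "- 1 - real n \<le> g m"
    using tame_bounds[OF g ab, of m] am by auto
  have k: "\<bar>g m - k\<bar> \<le> 1" "k \<in> {- int n - 2..1}"
    using gm unfolding k_def by (auto simp: floor_le_iff le_floor_iff) linarith+
  have p\<sigma>: "0 \<le> (\<sigma> - p) * d"
  proof -
    have "g m + \<sigma> * (a - m) \<le> g a" "g a + p * (m - a) \<le> g m"
      by (intro \<sigma> g0(5); use am in auto)+
    moreover have "a - m = - d" "m - a = d" by (simp_all add: d_def)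
    ultimately show ?thesis by (simp add: algebra_simps)
  qed
  have \<sigma>q: "0 \<le> (q - \<sigma>) * d"
  proof -
    have "g m + \<sigma> * (b - m) \<le> g b" "g b - q * (b - m) \<le> g m"
      by (intro \<sigma> g0(6); use am in auto)+
    then show ?thesis unfolding am(6) by (simp add: algebra_simps)
  qed
  have tot: "2 * ((\<sigma> - p) * d + (q - \<sigma>) * d) \<le> real n"
    using g0(4) unfolding am(3,4) by (simp add: algebra_simps)
  define n1 where "n1 = nat \<lceil>(\<sigma> - p) * d\<rceil>"
  define n2 where "n2 = nat \<lceil>(q - \<sigma>) * d\<rceil>"
  have n12: "(\<sigma> - p) * d \<le> real n1" "(q - \<sigma>) * d \<le> real n2"
    "real n1 < (\<sigma> - p) * d + 1" "real n2 < (q - \<sigma>) * d + 1"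
    using p\<sigma> \<sigma>q unfolding n1_def n2_def by linarith+
  have "2 * (x + y) < r + 4" if "x < v + 1" "y < w + 1" "2 * (v + w) \<le> r" for x y v w r :: real
    using that by simp
  from this[OF n12(3,4) tot] have "2 * (real n1 + real n2) < real n + 4" .
  then have "real (2 * (n1 + n2)) < real (n + 4)" by simp
  then have "2 * (n1 + n2) < n + 4" by (rule of_nat_less_imp_less)
  then have le: "2 * (n1 + n2) \<le> n + 3" by simp
  define c where "c = k / d"
  have cd: "c * d = k" using am by (simp add: c_def)
  show ?thesis
  proof (rule that[OF k(2) _ _ le])
    show "n1 \<le> n" "n2 \<le> n" using le n by auto
    have c1: "convex_on {a..m} g" "convex_on {m..b} g"
      by (rule convex_on_subset[OF g0(1)]; use am in auto)+
    have "(\<lambda>x. g x - (c * x - c * a)) \<in> tame a m (real n1)"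
    proof (rule tameI[where p = "p - c" and q = "\<sigma> - c"])
      show "convex_on {a..m} (\<lambda>x. g x - (c * x - c * a))"
        using convex_on_diff_affine[OF c1(1), of c "- c * a"] by simp
      show "\<bar>g a - (c * a - c * a)\<bar> \<le> 1" using g0(2) by simp
      have "c * m - c * a = k" using cd by (simp add: d_def algebra_simps)
      then show "\<bar>g m - (c * m - c * a)\<bar> \<le> 1" using k(1) by simp
      show "(\<sigma> - c - (p - c)) * (m - a) \<le> real n1" using n12(1) by (simp add: d_def)
    next
      fix x assume "x \<in> {a..m}"
      then have xab: "x \<in> {a..b}" using am(1,2) by auto
      show "g a - (c * a - c * a) + (p - c) * (x - a) \<le> g x - (c * x - c * a)"
        using g0(5)[OF xab] by (simp add: algebra_simps)
      show "g m - (c * m - c * a) - (\<sigma> - c) * (m - x) \<le> g x - (c * x - c * a)"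
        using \<sigma>[OF xab] by (simp add: algebra_simps)
    qed
    then show "(\<lambda>x. g x - (k / (m - a) * x - k / (m - a) * a)) \<in> tame a m (real n1)"
      by (simp add: c_def d_def)
    have "(\<lambda>x. g x - (- c * x + c * b)) \<in> tame m b (real n2)"
    proof (rule tameI[where p = "\<sigma> + c" and q = "q + c"])
      show "convex_on {m..b} (\<lambda>x. g x - (- c * x + c * b))"
        using convex_on_diff_affine[OF c1(2), of "- c" "c * b"] by simp
      show "\<bar>g b - (- c * b + c * b)\<bar> \<le> 1" using g0(3) by simp
      have "- c * m + c * b = k" using cd am(6) by (simp add: algebra_simps)
      then show "\<bar>g m - (- c * m + c * b)\<bar> \<le> 1" using k(1) by simp
      show "(q + c - (\<sigma> + c)) * (b - m) \<le> real n2" using n12(2) am(6) by simp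
    next
      fix x assume "x \<in> {m..b}"
      then have xab: "x \<in> {a..b}" using am(1,2) by auto
      show "g m - (- c * m + c * b) + (\<sigma> + c) * (x - m) \<le> g x - (- c * x + c * b)"
        using \<sigma>[OF xab] by (simp add: algebra_simps)
      show "g b - (- c * b + c * b) - (q + c) * (b - x) \<le> g x - (- c * x + c * b)"
        using g0(6)[OF xab] by (simp add: algebra_simps)
    qed
    then show "(\<lambda>x. g x - (- k / (m - a) * x + k / (m - a) * b)) \<in> tame m b (real n2)"
      by (simp add: c_def d_def)
  qed
qed

text \<open>The width never changes along the recursion, because the affine correction is added back
  to both ends of a bracket. Once \<open>n < 160000\<close>, one constant bracket suffices by
  \<open>tame_bounds\<close>; this fixes the width 160002. Before that, each choice of
  \<open>(k, n1, n2)\<close> splits the problem in two, and \<open>potential_step\<close> pays for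
  the choices.\<close>

lemma tame_covered:
  "a < b \<Longrightarrow> covered (sup_bracket 160002) {a..b} (exp (potential n)) (tame a b (real n))"
proof (induction n arbitrary: a b rule: less_induct)
  case (less n)
  show ?case
  proof (cases "n < 160000")
    case True
    show ?thesis
    proof (rule covered_single)
      show "sup_bracket 160002 (\<lambda>x. - 160001, \<lambda>x. 1)" by (simp add: sup_bracket_def)
      show "encloses {a..b} (\<lambda>x. - 160001, \<lambda>x. 1) f" if "f \<in> tame a b (real n)" for f
        using tame_bounds[OF that less.prems] True unfolding encloses_def by force
    qed (use potential_nonneg in auto)
  next
    case False
    define m where "m = (a + b) / 2"
    have am: "a < m" "m < b" using less.prems by (auto simp: m_def)
    define J where "J = {- int n - 2..1} \<times> {(n1, n2). n1 \<le> n \<and> n2 \<le> n \<and> 2 * (n1 + n2) \<le> n + 3}"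
    define P where "P = exp (potential n - ln ((real n + 4) * (real n + 1)\<^sup>2))"
    define F where "F = (\<lambda>(k :: int, n1 :: nat, n2 :: nat).
      {g. (\<lambda>x. g x - (k / (m - a) * x - k / (m - a) * a)) \<in> tame a m (real n1) \<and>
          (\<lambda>x. g x - (- k / (m - a) * x + k / (m - a) * b)) \<in> tame m b (real n2)})"
    have sub: "{(n1, n2). n1 \<le> n \<and> n2 \<le> n \<and> 2 * (n1 + n2) \<le> n + 3} \<subseteq> {..n} \<times> {..n}" by auto
    have fin: "finite J" unfolding J_def using finite_subset[OF sub] by simp
    have "card J \<le> card ({- int n - 2..1} \<times> ({..n} \<times> {..n}))"
      unfolding J_def by (intro card_mono) (use sub in auto)
    also have "\<dots> = (n + 4) * (n + 1)\<^sup>2"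
    proof -
      have "nat (4 + int n) = n + 4" by (simp add: nat_add_distrib)
      then show ?thesis by (simp add: card_cartesian_product power2_eq_square)
    qed
    finally have "real (card J) \<le> real ((n + 4) * (n + 1)\<^sup>2)" by (rule of_nat_mono)
    then have cJ: "real (card J) \<le> (real n + 4) * (real n + 1)\<^sup>2" by (simp add: add.commute)
    have "covered (sup_bracket 160002) {a..b} P (F j)" if j: "j \<in> J" for j
    proof -
      obtain k n1 n2 where jk: "j = (k, n1, n2)" by (cases j)
      have n12: "n1 \<le> n" "n2 \<le> n" "2 * (n1 + n2) \<le> n + 3" using j by (auto simp: J_def jk)
      then have lt: "n1 < n" "n2 < n" using False by auto
      have "covered (sup_bracket 160002) {a..m} (exp (potential n1)) (F j)"
        by (rule covered_shift[OF less.IH[OF lt(1) am(1)], where e = "\<lambda>x. k / (m - a) * x - k / (m - a) * a"])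
          (auto simp: F_def jk)
      moreover have "covered (sup_bracket 160002) {m..b} (exp (potential n2)) (F j)"
        by (rule covered_shift[OF less.IH[OF lt(2) am(2)], where e = "\<lambda>x. - k / (m - a) * x + k / (m - a) * b"])
          (auto simp: F_def jk)
      ultimately have "covered (sup_bracket 160002) {a..b} (exp (potential n1) * exp (potential n2)) (F j)"
        by (rule covered_glue[where m = m]) (use am in \<open>auto intro: sup_bracket_glue\<close>)
      then show ?thesis
        unfolding P_def
        by (rule covered_mono) (use potential_step[OF _ n12(3)] False in \<open>auto simp flip: exp_add\<close>)
    qed
    from covered_UN[OF fin this]
    have "covered (sup_bracket 160002) {a..b} (real (card J) * P) (\<Union>j\<in>J. F j)" .
    then show ?thesis
    proof (rule covered_mono)
      have "real (card J) * P \<le> ((real n + 4) * (real n + 1)\<^sup>2) * P"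
        using cJ by (intro mult_right_mono) (auto simp: P_def)
      also have "\<dots> = exp (potential n)"
        unfolding P_def exp_diff by (subst exp_ln) (auto intro!: mult_pos_pos add_nonneg_pos)
      finally show "real (card J) * P \<le> exp (potential n)" .
      show "tame a b (real n) \<subseteq> (\<Union>j\<in>J. F j)"
      proof
        fix g assume g: "g \<in> tame a b (real n)"
        have "4 \<le> n" using False by simp
        then obtain k :: int and n1 n2 :: nat where
          "k \<in> {- int n - 2..1}" "n1 \<le> n" "n2 \<le> n" "2 * (n1 + n2) \<le> n + 3"
          "(\<lambda>x. g x - (k / (m - a) * x - k / (m - a) * a)) \<in> tame a m (real n1)"
          "(\<lambda>x. g x - (- k / (m - a) * x + k / (m - a) * b)) \<in> tame m b (real n2)"
          by (rule tame_split[OF g less.prems _ m_def])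
        then show "g \<in> (\<Union>j\<in>J. F j)"
          by (intro UN_I[of "(k, n1, n2)"]) (auto simp: J_def F_def)
      qed
    qed
  qed
qed

section \<open>Negative powers of convex functions\<close>

text \<open>
  \<open>f = g powr (- \<alpha>)\<close> with \<open>g\<close> convex on \<open>S\<close> and allowed to be infinite, which means \<open>f = 0\<close>.
\<close>

definition root_concave :: "real \<Rightarrow> real set \<Rightarrow> (real \<Rightarrow> real) \<Rightarrow> bool" where
  "root_concave \<alpha> S f \<longleftrightarrow>
     (\<forall>x\<in>S. \<forall>y\<in>S. \<forall>t. 0 \<le> t \<and> t \<le> 1 \<and> 0 < f x \<and> 0 < f y \<longrightarrow>
        0 < f ((1 - t) * x + t * y) \<and>
        f ((1 - t) * x + t * y) powr (- 1 / \<alpha>)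
          \<le> (1 - t) * f x powr (- 1 / \<alpha>) + t * f y powr (- 1 / \<alpha>))"

lemma root_concaveD:
  assumes "root_concave \<alpha> S f" "x \<in> S" "y \<in> S" "0 \<le> t" "t \<le> 1" "0 < f x" "0 < f y"
  shows "0 < f ((1 - t) * x + t * y)"
    "f ((1 - t) * x + t * y) powr (- 1 / \<alpha>) \<le> (1 - t) * f x powr (- 1 / \<alpha>) + t * f y powr (- 1 / \<alpha>)"
  using assms unfolding root_concave_def by blast+

lemma root_concave_subset: "root_concave \<alpha> S f \<Longrightarrow> T \<subseteq> S \<Longrightarrow> root_concave \<alpha> T f"
  unfolding root_concave_def by blast

definition antimono_root_concave :: "real \<Rightarrow> real \<Rightarrow> real \<Rightarrow> real \<Rightarrow> (real \<Rightarrow> real) set" where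
  "antimono_root_concave \<alpha> A a b = {f. (\<forall>x\<in>{a..b}. 0 \<le> f x \<and> f x \<le> A) \<and> antimono_on {a..b} f \<and> root_concave \<alpha> {a..b} f}"

definition nonneg_sup_bracket :: "real \<Rightarrow> (real \<Rightarrow> real) \<times> (real \<Rightarrow> real) \<Rightarrow> bool" where
  "nonneg_sup_bracket w b \<longleftrightarrow> sup_bracket w b \<and> (\<forall>x. 0 \<le> fst b x)"

lemma powr_minus_diff_le:
  fixes \<alpha> G y z :: real
  assumes "0 < \<alpha>" "0 < G" "G \<le> y" "y \<le> z"
  shows "y powr (- \<alpha>) - z powr (- \<alpha>) \<le> \<alpha> * G powr (- \<alpha> - 1) * (z - y)"
proof (cases "y = z")
  case False
  then have yz: "y < z" using assms by simp
  have "((\<lambda>x. x powr (- \<alpha>)) has_real_derivative (- \<alpha>) * x powr (- \<alpha> - 1)) (at x)" if "y \<le> x" "x \<le> z" for x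
    using that assms by (intro has_real_derivative_powr) auto
  from MVT2[OF yz this] obtain x where x: "y < x" "x < z"
    "z powr (- \<alpha>) - y powr (- \<alpha>) = (z - y) * ((- \<alpha>) * x powr (- \<alpha> - 1))" by blast
  have "x powr (- \<alpha> - 1) \<le> G powr (- \<alpha> - 1)"
    using x assms by (intro powr_mono2') auto
  then have "(z - y) * (\<alpha> * x powr (- \<alpha> - 1)) \<le> (z - y) * (\<alpha> * G powr (- \<alpha> - 1))"
    using assms yz by (intro mult_left_mono) auto
  then show ?thesis using x(3) by (simp add: algebra_simps)
qed simp

text \<open>The function \<open>f powr (- 1 / \<alpha>) / \<tau>\<close> is convex, nondecreasing
  and at most \<open>V\<close> on the first half. Monotonicity makes 0 a supporting slope at
  \<open>a\<close>, and the second quarter is room for bounding the slope at the end of the first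
  one. The integers \<open>k1\<close>, \<open>k2\<close> round the end values, and the affine
  function through them is removed.\<close>

lemma antimono_root_concave_scaled_tame:
  fixes \<alpha> \<rho> A X a b :: real
  assumes \<alpha>: "0 < \<alpha>" and \<rho>: "0 < \<rho>" "\<rho> \<le> 1" and A: "0 < A" and ab: "a < b"
    and f: "f \<in> antimono_root_concave \<alpha> A a b" "\<rho> * A \<le> f ((a + b) / 2)" and \<tau>: "0 < \<tau>"
  defines "d \<equiv> (b - a) / 4"
  defines "V \<equiv> (\<rho> * A) powr (- 1 / \<alpha>) / \<tau>"
  obtains k1 k2 :: int where "k1 \<in> {0..\<lfloor>V\<rfloor>}" "k2 \<in> {0..\<lfloor>V\<rfloor>}"
    "(\<lambda>x. f x powr (- 1 / \<alpha>) / \<tau> - ((k2 - k1) / d * x + (k1 - (k2 - k1) / d * a)))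
        \<in> tame a (a + d) (real (nat \<lceil>V\<rceil>))"
proof -
  define m where "m = a + 2 * d"
  have m: "m = (a + b) / 2" "a < m" "m < b" "0 < d" using ab by (auto simp: m_def d_def field_simps)
  have f0: "\<And>x. x \<in> {a..b} \<Longrightarrow> f x \<le> A" "antimono_on {a..b} f" "root_concave \<alpha> {a..b} f"
    using f(1) by (auto simp: antimono_root_concave_def)
  define g where "g = (\<lambda>x. f x powr (- 1 / \<alpha>))"
  have fl: "\<rho> * A \<le> f x" if "x \<in> {a..m}" for x
    using f(2) monotone_onD[OF f0(2), of x m] that m by auto
  have \<rho>A: "0 < \<rho> * A" using \<rho> A by simp
  have fpos: "0 < f x" if "x \<in> {a..m}" for x using fl[OF that] \<rho>A by linarith
  have gV: "g x / \<tau> \<le> V" "0 \<le> g x / \<tau>" if "x \<in> {a..m}" for x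
    using fl[OF that] \<rho>A \<alpha> \<tau> unfolding V_def g_def
    by (auto intro!: divide_right_mono powr_mono2')
  have gmono: "g x / \<tau> \<le> g y / \<tau>" if "x \<in> {a..m}" "y \<in> {a..m}" "x \<le> y" for x y
    using monotone_onD[OF f0(2), of x y] fpos[OF that(2)] that m \<alpha> \<tau> unfolding g_def
    by (auto intro!: divide_right_mono powr_mono2')
  have cg: "convex_on {a..m} g"
  proof (rule convex_onI)
    fix t x y :: real assume "0 < t" "t < 1" "x \<in> {a..m}" "y \<in> {a..m}"
    then show "g ((1 - t) *\<^sub>R x + t *\<^sub>R y) \<le> (1 - t) * g x + t * g y"
      using root_concaveD(2)[OF f0(3), of x y t] fpos[of x] fpos[of y] m unfolding g_def by auto
  qed simp
  define e where "e = (\<lambda>x. g x / \<tau>)"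
  have ce: "convex_on {a..m} e" unfolding e_def using \<tau> by (intro convex_on_cdiv cg) auto
  obtain \<sigma> where \<sigma>: "\<And>x. x \<in> {a..m} \<Longrightarrow> e (a + d) + \<sigma> * (x - (a + d)) \<le> e x"
    using convex_subgradient[OF ce, of "a + d"] m unfolding m_def by auto
  define k1 where "k1 = \<lfloor>e a\<rfloor>"
  define k2 where "k2 = \<lfloor>e (a + d)\<rfloor>"
  define c where "c = (k2 - k1) / d"
  have mem: "a \<in> {a..m}" "a + d \<in> {a..m}" "m \<in> {a..m}" using m by (auto simp: m_def)
  have "k1 \<in> {0..\<lfloor>V\<rfloor>}" "k2 \<in> {0..\<lfloor>V\<rfloor>}"
    unfolding k1_def k2_def e_def using gV[OF mem(1)] gV[OF mem(2)] by (auto intro!: floor_mono)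
  moreover have "(\<lambda>x. e x - (c * x + (k1 - c * a))) \<in> tame a (a + d) (real (nat \<lceil>V\<rceil>))"
  proof (rule tameI[where p = "- c" and q = "\<sigma> - c"])
    show "convex_on {a..a + d} (\<lambda>x. e x - (c * x + (k1 - c * a)))"
      by (intro convex_on_diff_affine convex_on_subset[OF ce]) (use m in \<open>auto simp: m_def\<close>)
    show "\<bar>e a - (c * a + (k1 - c * a))\<bar> \<le> 1" unfolding k1_def by (simp add: abs_le_iff) linarith
    have "c * (a + d) + (k1 - c * a) = k2" using m(4) by (simp add: c_def field_simps)
    then show "\<bar>e (a + d) - (c * (a + d) + (k1 - c * a))\<bar> \<le> 1"
      unfolding k2_def by (simp add: abs_le_iff) linarith
    \<comment> \<open>The support line at the quarter point has to stay below \<open>V\<close> over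
      a further length \<open>d\<close>, so its slope times \<open>d\<close> is at most
      \<open>V\<close>.\<close>
    have "e (a + d) + \<sigma> * (m - (a + d)) \<le> e m" using \<sigma>[OF mem(3)] .
    moreover have "0 \<le> e (a + d)" "e m \<le> V" using gV[OF mem(2)] gV[OF mem(3)] by (auto simp: e_def)
    moreover have "m - (a + d) = d" by (simp add: m_def)
    ultimately have "\<sigma> * d \<le> V" by simp
    then show "(\<sigma> - c - - c) * (a + d - a) \<le> real (nat \<lceil>V\<rceil>)"
      using real_nat_ceiling_ge[of V] by simp
  next
    fix x assume "x \<in> {a..a + d}"
    then have x: "x \<in> {a..m}" "a \<le> x" using m by (auto simp: m_def)
    have "e a \<le> e x" using gmono[OF mem(1) x] by (simp add: e_def)
    then show "e a - (c * a + (k1 - c * a)) + - c * (x - a) \<le> e x - (c * x + (k1 - c * a))"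
      by (simp add: algebra_simps)
    show "e (a + d) - (c * (a + d) + (k1 - c * a)) - (\<sigma> - c) * (a + d - x) \<le> e x - (c * x + (k1 - c * a))"
      using \<sigma>[OF x(1)] by (simp add: algebra_simps)
  qed
  ultimately show ?thesis
    using that unfolding e_def g_def c_def by blast
qed

text \<open>On the scale of \<open>g = f powr (- 1 / \<alpha>)\<close> the function is Lipschitz on
  the first quarter, with \<open>V\<close> proportional to \<open>X^2\<close> when the precision is
  \<open>A / X^2\<close>. The uniform estimate costs about \<open>sqrt V\<close>, hence a multiple
  of \<open>X\<close>, and the roundings of the end values are polynomially many in
  \<open>V\<close>.\<close>

lemma antimono_root_concave_comparable_covered:
  fixes \<alpha> \<rho> :: real
  assumes \<alpha>: "0 < \<alpha>" and \<rho>: "0 < \<rho>" "\<rho> \<le> 1"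
  obtains c where "0 \<le> c" "\<And>A a b X. 0 < A \<Longrightarrow> a < b \<Longrightarrow> 1 \<le> X \<Longrightarrow>
    covered (nonneg_sup_bracket (A / X\<^sup>2)) {a..a + (b - a) / 4} (exp (c * X))
      {f \<in> antimono_root_concave \<alpha> A a b. \<rho> * A \<le> f ((a + b) / 2)}"
proof -
  define W :: real where "W = 160002"
  define \<beta> where "\<beta> = \<rho> powr (- 1 / \<alpha>) * \<alpha> * W"
  have \<beta>: "0 \<le> \<beta>" using \<alpha> by (simp add: \<beta>_def W_def)
  show ?thesis
  proof (rule that[of "104 * sqrt \<beta> + 200"])
    show "0 \<le> 104 * sqrt \<beta> + 200" using \<beta> by simp
    fix A a b X :: real assume A: "0 < A" and ab: "a < b" and X: "1 \<le> X"
    define F where "F = {f \<in> antimono_root_concave \<alpha> A a b. \<rho> * A \<le> f ((a + b) / 2)}"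
    define G where "G = A powr (- 1 / \<alpha>)"
    \<comment> \<open>Since \<open>f \<le> A\<close> means \<open>g \<ge> G\<close>, the derivative
      of \<open>y powr (- \<alpha>)\<close> has modulus at most
      \<open>\<alpha> * G powr (- \<alpha> - 1)\<close> there. This \<open>\<tau>\<close> makes a
      width \<open>\<tau> * W\<close> in \<open>g\<close> become exactly \<open>A / X^2\<close> in
      \<open>f\<close>.\<close>
    define \<tau> where "\<tau> = G / (\<alpha> * W * X\<^sup>2)"
    define V where "V = (\<rho> * A) powr (- 1 / \<alpha>) / \<tau>"
    define d where "d = (b - a) / 4"
    define n where "n = nat \<lceil>V\<rceil>"
    have G: "0 < G" using A by (simp add: G_def)
    have \<tau>: "0 < \<tau>" using G \<alpha> X by (simp add: \<tau>_def W_def)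
    have d: "0 < d" using ab by (simp add: d_def)
    have V\<beta>: "V = \<beta> * X\<^sup>2"
      using G \<alpha> X \<rho> A unfolding V_def \<tau>_def \<beta>_def G_def W_def by (simp add: powr_mult field_simps)
    have V0: "0 \<le> V" using V\<beta> \<beta> by simp
    define J where "J = {0..\<lfloor>V\<rfloor>} \<times> {0..\<lfloor>V\<rfloor>}"
    define L where "L = (\<lambda>(k1 :: int, k2 :: int) x. (k2 - k1) / d * x + (k1 - (k2 - k1) / d * a))"
    define E where "E = (\<lambda>j. {f \<in> F. (\<lambda>x. f x powr (- 1 / \<alpha>) / \<tau> - L j x) \<in> tame a (a + d) (real n)})"
    have GA: "G powr (- \<alpha>) = A" using A \<alpha> by (simp add: G_def powr_powr)
    \<comment> \<open>The negative power is decreasing, so upper ends give lower ends. Truncating at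
      \<open>G\<close> costs nothing, as \<open>g \<ge> G\<close>, and keeps the power in the range
      where its derivative is controlled.\<close>
    have cov: "covered (nonneg_sup_bracket (A / X\<^sup>2)) {a..a + d} (exp (potential n)) (E j)" if "j \<in> J" for j
    proof (rule covered_map[OF tame_covered, where
          T = "\<lambda>b. (\<lambda>x. max G (\<tau> * (snd b x + L j x)) powr (- \<alpha>), \<lambda>x. max G (\<tau> * (fst b x + L j x)) powr (- \<alpha>))"])
      show "a < a + d" using d by simp
      have Lm[measurable]: "L j \<in> borel_measurable borel" unfolding L_def by (cases j) simp
      fix p :: "(real \<Rightarrow> real) \<times> (real \<Rightarrow> real)" assume p: "sup_bracket 160002 p"
      then have [measurable]: "fst p \<in> borel_measurable borel" "snd p \<in> borel_measurable borel"
        by (auto simp: sup_bracket_def)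
      have "max G (\<tau> * (snd p x + L j x)) powr (- \<alpha>) \<le> max G (\<tau> * (fst p x + L j x)) powr (- \<alpha>) \<and>
        max G (\<tau> * (fst p x + L j x)) powr (- \<alpha>) \<le> max G (\<tau> * (snd p x + L j x)) powr (- \<alpha>) + A / X\<^sup>2" for x
      proof -
        define y where "y = max G (\<tau> * (fst p x + L j x))"
        define z where "z = max G (\<tau> * (snd p x + L j x))"
        have px: "fst p x \<le> snd p x" "snd p x \<le> fst p x + W" using p by (auto simp: sup_bracket_def W_def)
        then have le: "\<tau> * (fst p x + L j x) \<le> \<tau> * (snd p x + L j x)"
          "\<tau> * (snd p x + L j x) \<le> \<tau> * (fst p x + L j x + W)"
          using \<tau> by (auto intro!: mult_left_mono)
        have yz: "G \<le> y" "y \<le> z" unfolding y_def z_def using le(1) by auto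
        have "z \<le> y + \<tau> * W"
          unfolding y_def z_def using le(2) \<tau> by (auto simp: distrib_left W_def max_def)
        have "z powr (- \<alpha>) \<le> y powr (- \<alpha>)" using yz G \<alpha> by (intro powr_mono2') auto
        moreover have "y powr (- \<alpha>) - z powr (- \<alpha>) \<le> \<alpha> * G powr (- \<alpha> - 1) * (z - y)"
          by (rule powr_minus_diff_le[OF \<alpha> G yz])
        moreover have "\<alpha> * G powr (- \<alpha> - 1) * (z - y) \<le> \<alpha> * G powr (- \<alpha> - 1) * (\<tau> * W)"
          using \<open>z \<le> y + \<tau> * W\<close> \<alpha> by (intro mult_left_mono) auto
        moreover have "\<alpha> * G powr (- \<alpha> - 1) * (\<tau> * W) = A / X\<^sup>2"
          using \<alpha> G X GA unfolding \<tau>_def W_def powr_diff by (simp add: field_simps)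
        ultimately show ?thesis unfolding y_def z_def by linarith
      qed
      then show "nonneg_sup_bracket (A / X\<^sup>2) (\<lambda>x. max G (\<tau> * (snd p x + L j x)) powr (- \<alpha>),
          \<lambda>x. max G (\<tau> * (fst p x + L j x)) powr (- \<alpha>))"
        unfolding nonneg_sup_bracket_def sup_bracket_def by simp
    next
      fix f assume f: "f \<in> E j"
      let ?g = "\<lambda>x. f x powr (- 1 / \<alpha>) / \<tau> - L j x"
      have "encloses {a..a + d} (\<lambda>x. max G (\<tau> * (snd p x + L j x)) powr (- \<alpha>),
          \<lambda>x. max G (\<tau> * (fst p x + L j x)) powr (- \<alpha>)) f"
        if p: "encloses {a..a + d} p ?g" for p
        unfolding encloses_def
      proof (intro ballI)
        fix x assume x: "x \<in> {a..a + d}"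
        have fF: "f \<in> antimono_root_concave \<alpha> A a b" "\<rho> * A \<le> f ((a + b) / 2)" using f by (auto simp: E_def F_def)
        have x2: "x \<in> {a..b}" "(a + b) / 2 \<in> {a..b}" "x \<le> (a + b) / 2"
          using x ab by (auto simp: d_def field_simps)
        have "f ((a + b) / 2) \<le> f x"
          using fF(1) x2 unfolding antimono_root_concave_def monotone_on_def by blast
        then have fx: "0 < f x" using fF(2) mult_pos_pos[OF \<rho>(1) A] by linarith
        have fA: "f x \<le> A" using fF(1) x2(1) unfolding antimono_root_concave_def by blast
        define g where "g = f x powr (- 1 / \<alpha>)"
        have gG: "G \<le> g" unfolding G_def g_def using fx fA \<alpha> by (intro powr_mono2') auto
        have fg: "f x = g powr (- \<alpha>)" using fx \<alpha> by (simp add: g_def powr_powr)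
        have pg: "fst p x + L j x \<le> g / \<tau>" "g / \<tau> \<le> snd p x + L j x"
          using p x by (auto simp: encloses_def g_def algebra_simps)
        have "\<tau> * (fst p x + L j x) \<le> g" "g \<le> \<tau> * (snd p x + L j x)"
          using mult_left_mono[OF pg(1), of \<tau>] mult_left_mono[OF pg(2), of \<tau>] \<tau> by auto
        then show "fst (\<lambda>x. max G (\<tau> * (snd p x + L j x)) powr (- \<alpha>),
              \<lambda>x. max G (\<tau> * (fst p x + L j x)) powr (- \<alpha>)) x \<le> f x \<and>
            f x \<le> snd (\<lambda>x. max G (\<tau> * (snd p x + L j x)) powr (- \<alpha>),
              \<lambda>x. max G (\<tau> * (fst p x + L j x)) powr (- \<alpha>)) x"
          unfolding fg fst_conv snd_conv using gG G \<alpha> by (auto intro!: powr_mono2')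
      qed
      then show "\<exists>g\<in>tame a (a + d) (real n). \<forall>p. sup_bracket 160002 p \<longrightarrow> encloses {a..a + d} p g \<longrightarrow>
          encloses {a..a + d} (\<lambda>x. max G (\<tau> * (snd p x + L j x)) powr (- \<alpha>),
            \<lambda>x. max G (\<tau> * (fst p x + L j x)) powr (- \<alpha>)) f"
        using f unfolding E_def by blast
    qed
    have c1: "covered (nonneg_sup_bracket (A / X\<^sup>2)) {a..a + d} (real (card J) * exp (potential n)) (\<Union>j\<in>J. E j)"
      by (rule covered_UN[OF _ cov]) (simp add: J_def)
    have c2: "F \<subseteq> (\<Union>j\<in>J. E j)"
    proof
      fix f assume f: "f \<in> F"
      then have f': "f \<in> antimono_root_concave \<alpha> A a b" "\<rho> * A \<le> f ((a + b) / 2)" by (auto simp: F_def)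
      obtain k1 k2 :: int where "k1 \<in> {0..\<lfloor>V\<rfloor>}" "k2 \<in> {0..\<lfloor>V\<rfloor>}"
        "(\<lambda>x. f x powr (- 1 / \<alpha>) / \<tau> - ((k2 - k1) / d * x + (k1 - (k2 - k1) / d * a)))
          \<in> tame a (a + d) (real n)"
        using antimono_root_concave_scaled_tame[OF \<alpha> \<rho> A ab f' \<tau>] unfolding d_def V_def n_def by blast
      then show "f \<in> (\<Union>j\<in>J. E j)"
        using f by (intro UN_I[of "(k1, k2)"]) (auto simp: J_def E_def L_def)
    qed
    \<comment> \<open>The choices of \<open>(k1, k2)\<close> contribute \<open>4 * s\<close> to the
      exponent and the potential \<open>100 * (s + 2)\<close>; the constant 200 is absorbed by
      \<open>1 \<le> X\<close>.\<close>
    have c3: "real (card J) * exp (potential n) \<le> exp ((104 * sqrt \<beta> + 200) * X)"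
    proof -
      define s where "s = sqrt \<beta> * X"
      have s: "0 \<le> s" "V = s\<^sup>2" using \<beta> X by (simp_all add: s_def V\<beta> power_mult_distrib)
      have nV: "real n \<le> V + 1" unfolding n_def using V0 by linarith
      have "real (card J) = (real_of_int \<lfloor>V\<rfloor> + 1)\<^sup>2"
        using V0 by (simp add: J_def card_cartesian_product power2_eq_square)
      also have "\<dots> \<le> (V + 1)\<^sup>2" using V0 by (intro power_mono add_mono) auto
      also have "\<dots> \<le> ((1 + s)\<^sup>2)\<^sup>2"
        using s by (intro power_mono) (auto simp: power2_eq_square algebra_simps)
      also have "\<dots> \<le> (exp s) ^ 4"
        unfolding power_mult[symmetric] using s exp_ge_add_one_self[of s] by (auto intro!: power_mono)
      also have "\<dots> = exp (4 * s)" by (simp add: exp_of_nat_mult[symmetric])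
      finally have J1: "real (card J) \<le> exp (4 * s)" .
      have "real n + 1 \<le> (s + 2)\<^sup>2" using nV s by (simp add: power2_eq_square algebra_simps)
      then have "sqrt (real n + 1) \<le> s + 2" using s by (intro real_le_lsqrt) auto
      moreover have "0 \<le> sqrt (sqrt (real n + 1))" by simp
      ultimately have "potential n \<le> 100 * (s + 2)"
        unfolding potential_def by (intro mult_left_mono) linarith+
      then have "real (card J) * exp (potential n) \<le> exp (4 * s) * exp (100 * (s + 2))"
        using J1 by (intro mult_mono) auto
      also have "\<dots> = exp (104 * s + 200)" by (simp add: exp_add[symmetric])
      also have "\<dots> \<le> exp ((104 * sqrt \<beta> + 200) * X)" using X by (simp add: s_def algebra_simps)
      finally show ?thesis .
    qed
    show "covered (nonneg_sup_bracket (A / X\<^sup>2)) {a..a + (b - a) / 4} (exp ((104 * sqrt \<beta> + 200) * X))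
      {f \<in> antimono_root_concave \<alpha> A a b. \<rho> * A \<le> f ((a + b) / 2)}"
      using covered_mono[OF c1 c3 c2] unfolding F_def d_def by blast
  qed
qed

section \<open>Brackets of small integrated size\<close>

definition Lr_bracket :: "real \<Rightarrow> real set \<Rightarrow> real \<Rightarrow> (real \<Rightarrow> real) \<times> (real \<Rightarrow> real) \<Rightarrow> bool" where
  "Lr_bracket r I E b \<longleftrightarrow> fst b \<in> borel_measurable borel \<and> snd b \<in> borel_measurable borel \<and>
     (\<forall>x. 0 \<le> fst b x \<and> fst b x \<le> snd b x) \<and>
     (\<integral>\<^sup>+x. ennreal ((snd b x - fst b x) powr r) * indicator I x \<partial>lborel) \<le> ennreal E"

lemma Lr_bracket_mono: "Lr_bracket r I E b \<Longrightarrow> E \<le> E' \<Longrightarrow> Lr_bracket r I E' b"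
  unfolding Lr_bracket_def using ennreal_leI order_trans by blast

text \<open>The tolerance \<open>E\<close> bounds the r-th power of the distance, an integral, and
  is therefore additive over adjacent pieces.\<close>

lemma Lr_bracket_glue:
  assumes "Lr_bracket r I1 E1 b" "Lr_bracket r I2 E2 c" "0 \<le> E1" "0 \<le> E2"
    "I \<inter> {..m} \<subseteq> I1" "I \<inter> {m<..} \<subseteq> I2" "I1 \<in> sets borel" "I2 \<in> sets borel"
  shows "Lr_bracket r I (E1 + E2) (glue m b c)"
proof -
  note [measurable] = assms(7,8)
  have [measurable]: "fst b \<in> borel_measurable borel" "snd b \<in> borel_measurable borel"
    "fst c \<in> borel_measurable borel" "snd c \<in> borel_measurable borel"
    using assms(1,2) by (auto simp: Lr_bracket_def)
  let ?i = "\<lambda>I b x. ennreal ((snd b x - fst b x) powr r) * indicator I x"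
  have "(\<integral>\<^sup>+x. ?i I (glue m b c) x \<partial>lborel) \<le> (\<integral>\<^sup>+x. ?i I1 b x + ?i I2 c x \<partial>lborel)"
    using assms(5,6) by (intro nn_integral_mono) (auto simp: glue_def indicator_def not_le subset_iff)
  also have "\<dots> = (\<integral>\<^sup>+x. ?i I1 b x \<partial>lborel) + (\<integral>\<^sup>+x. ?i I2 c x \<partial>lborel)"
    by (intro nn_integral_add) measurable
  also have "\<dots> \<le> ennreal E1 + ennreal E2"
    using assms(1,2) by (intro add_mono) (auto simp: Lr_bracket_def)
  finally show ?thesis
    using assms(1-4) unfolding Lr_bracket_def by (auto simp: glue_def ennreal_plus)
qed

lemma Lr_bracket_nonneg_sup_bracket:
  assumes "nonneg_sup_bracket w b" "p \<le> q" "0 \<le> r"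
  shows "Lr_bracket r {p..q} (w powr r * (q - p)) b"
proof -
  have b: "fst b \<in> borel_measurable borel" "snd b \<in> borel_measurable borel"
    "\<And>x. 0 \<le> fst b x" "\<And>x. fst b x \<le> snd b x" "\<And>x. snd b x - fst b x \<le> w"
    using assms(1) by (auto simp: nonneg_sup_bracket_def sup_bracket_def algebra_simps)
  have "(\<integral>\<^sup>+x. ennreal ((snd b x - fst b x) powr r) * indicator {p..q} x \<partial>lborel)
      \<le> (\<integral>\<^sup>+x. ennreal (w powr r) * indicator {p..q} x \<partial>lborel)"
    using b(4,5) assms(3) by (intro nn_integral_mono mult_right_mono ennreal_leI powr_mono2) auto
  also have "\<dots> = ennreal (w powr r) * ennreal (q - p)"
    using assms(2) by (simp add: nn_integral_cmult_indicator)
  also have "\<dots> = ennreal (w powr r * (q - p))" using assms(2) by (simp add: ennreal_mult)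
  finally show ?thesis using b unfolding Lr_bracket_def by auto
qed

text \<open>The common step of all recursions below. \<open>I\<close> and \<open>J\<close> are left
  general so that it serves bounded intervals and half-lines alike.\<close>

lemma covered_Lr_glue:
  assumes "covered (Lr_bracket r {a..m} E1) {a..m} N1 F" "covered (Lr_bracket r J E2) J N2 F"
    "0 \<le> E1" "0 \<le> E2" "E1 + E2 \<le> E" "N1 * N2 \<le> N" "J \<in> sets borel" "I \<inter> {m<..} \<subseteq> J" "I \<subseteq> {a..}"
  shows "covered (Lr_bracket r I E) I N F"
proof -
  have "covered (Lr_bracket r I (E1 + E2)) I (N1 * N2) F"
    by (rule covered_glue[OF assms(1,2), where m = m])
      (use assms in \<open>auto intro!: Lr_bracket_glue[where ?I1.0 = "{a..m}" and ?I2.0 = J]\<close>)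
  then show ?thesis
    by (rule covered_mono) (use assms Lr_bracket_mono in auto)
qed

lemma trivial_covered:
  assumes "0 \<le> A" "a \<le> b" "0 \<le> r" "1 \<le> N" "A powr r * (b - a) \<le> E"
    "\<And>f x. f \<in> F \<Longrightarrow> x \<in> {a..b} \<Longrightarrow> 0 \<le> f x \<and> f x \<le> A"
  shows "covered (Lr_bracket r {a..b} E) {a..b} N F"
proof (rule covered_single)
  have "nonneg_sup_bracket A (\<lambda>x. 0, \<lambda>x. A)" using assms(1) by (simp add: nonneg_sup_bracket_def sup_bracket_def)
  from Lr_bracket_nonneg_sup_bracket[OF this assms(2,3)] assms(5)
  show "Lr_bracket r {a..b} E (\<lambda>x. 0, \<lambda>x. A)" by (rule Lr_bracket_mono)
qed (use assms in \<open>auto simp: encloses_def\<close>)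

lemma antimono_root_concave_subset:
  assumes "f \<in> antimono_root_concave \<alpha> A a b" "a \<le> c" "d \<le> b" "\<And>x. x \<in> {c..d} \<Longrightarrow> f x \<le> B"
  shows "f \<in> antimono_root_concave \<alpha> B c d"
proof -
  have "{c..d} \<subseteq> {a..b}" using assms by auto
  then show ?thesis
    using assms unfolding antimono_root_concave_def
    by (auto intro: monotone_on_subset root_concave_subset)
qed

text \<open>A union of two families at most doubles the count, and \<open>2 \<le> exp 1\<close>: a
  case distinction costs one unit in the exponent.\<close>

lemma exp_sum_le:
  fixes x y z :: real
  assumes "x \<le> z - 1" "y \<le> z - 1"
  shows "exp x + exp y \<le> exp z"
proof -
  have "exp x + exp y \<le> 2 * exp (z - 1)" using assms by (smt (verit) exp_le_cancel_iff)
  also have "\<dots> \<le> exp 1 * exp (z - 1)"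
    using exp_ge_add_one_self[of 1] by (intro mult_right_mono) auto
  finally show ?thesis by (simp add: exp_add[symmetric])
qed

text \<open>With \<open>q = 1 / (4 * r)\<close> and \<open>\<rho> = s ^ 4\<close>, the power
  \<open>(\<rho> powr r) powr q\<close> is exactly \<open>s\<close>. Taking
  \<open>1 + s = 2 powr (q / 2)\<close> turns the sum of the two \<open>q\<close>-th powers into
  \<open>(1 / 2) powr (q / 2)\<close>, which is below one; this controls the counts. The last
  conclusion controls the errors and holds because \<open>s \<le> 0.42\<close>. The bound on
  \<open>(3 / 4) powr q\<close> serves the case in which three quarters of the interval
  remain.\<close>

lemma splitting_ratio:
  fixes r :: real
  assumes r: "1 \<le> r"
  obtains \<rho> \<theta> where "0 < \<rho>" "\<rho> \<le> 1" "\<theta> < 1" "(3 / 4) powr (1 / (4 * r)) \<le> \<theta>"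
    "(1 / 2) powr (1 / (4 * r)) + (\<rho> powr r * (1 / 2)) powr (1 / (4 * r)) \<le> \<theta>"
    "1 + sqrt (\<rho> powr r) \<le> sqrt 2"
proof -
  define q where "q = 1 / (4 * r)"
  have q: "0 < q" "q \<le> 1 / 4" "r * q = 1 / 4" using r by (auto simp: q_def field_simps)
  define s :: real where "s = 2 powr (q / 2) - 1"
  have s0: "0 < s" using q powr_less_mono[of 0 "q / 2" 2] by (simp add: s_def)
  have "2 powr (q / 2) \<le> 2 powr (1 / 2)" using q by (intro powr_mono) auto
  also have "\<dots> = sqrt 2" by (simp add: powr_half_sqrt)
  also have "\<dots> \<le> 1.42" by (intro real_le_lsqrt) (auto simp: power2_eq_square)
  finally have s1: "s \<le> 0.42" by (simp add: s_def)
  define \<rho> where "\<rho> = s ^ 4"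
  have "s ^ 4 \<le> s ^ 0" using s0 s1 by (intro power_decreasing) auto
  then have \<rho>: "0 < \<rho>" "\<rho> \<le> 1" using s0 by (auto simp: \<rho>_def)
  have "\<rho> = s powr 4" unfolding \<rho>_def using s0 by (simp add: powr_numeral)
  then have "\<rho> powr (1 / 4) = s powr (4 * (1 / 4))" by (simp only: powr_powr)
  then have \<rho>4: "\<rho> powr (1 / 4) = s" using s0 by simp
  define \<theta> where "\<theta> = max ((3 / 4) powr q) ((1 / 2) powr (q / 2) :: real)"
  show ?thesis
  proof (rule that[OF \<rho>, of \<theta>])
    have "(3 / 4 :: real) powr q < 1 powr q" "(1 / 2 :: real) powr (q / 2) < 1 powr (q / 2)"
      by (intro powr_less_mono2; use q in simp)+
    then show "\<theta> < 1" by (simp add: \<theta>_def)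
    show "(3 / 4) powr (1 / (4 * r)) \<le> \<theta>" by (simp add: \<theta>_def q_def)
    have "(\<rho> powr r * (1 / 2)) powr q = s * (1 / 2) powr q"
    proof -
      have "(\<rho> powr r * (1 / 2)) powr q = (\<rho> powr r) powr q * (1 / 2) powr q"
        by (rule powr_mult)
      then show ?thesis unfolding powr_powr q(3) \<rho>4 .
    qed
    then have "(1 / 2) powr q + (\<rho> powr r * (1 / 2)) powr q = (1 / 2) powr q * 2 powr (q / 2)"
      by (simp add: s_def algebra_simps)
    also have "\<dots> = (1 / 2) powr (q / 2)"
    proof -
      have half: "(1 / 2 :: real) powr t = 2 powr (- t)" for t
        by (simp add: powr_divide powr_minus_divide)
      show ?thesis unfolding half by (simp flip: powr_add)
    qed
    finally show "(1 / 2) powr (1 / (4 * r)) + (\<rho> powr r * (1 / 2)) powr (1 / (4 * r)) \<le> \<theta>"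
      by (simp add: \<theta>_def q_def)
    have "\<rho> powr r \<le> \<rho> powr 1" using \<rho> r by (intro powr_mono') auto
    then have "sqrt (\<rho> powr r) \<le> sqrt \<rho>" using \<rho> by simp
    also have "\<dots> = s\<^sup>2" unfolding \<rho>_def using s0 by (intro real_sqrt_unique) auto
    also have "\<dots> \<le> 0.42\<^sup>2" using s0 s1 by (intro power_mono) auto
    finally have "1 + sqrt (\<rho> powr r) \<le> 1.4" by (simp add: power2_eq_square)
    also have "\<dots> \<le> sqrt 2" by (intro real_le_rsqrt) (simp add: power2_eq_square)
    finally show "1 + sqrt (\<rho> powr r) \<le> sqrt 2" .
  qed
qed

text \<open>
  Here \<open>Y\<close> is the \<open>r\<close>-th power of the \<open>L_r\<close>-size of the trivial bracket \<open>[0, A]\<close>, which suffices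
  when \<open>Y \<le> Z\<close>. Otherwise, with \<open>X = (Y / Z) powr (1 / (4 * r))\<close>, a steep function (one that
  falls below \<open>\<rho> A\<close> on the first half) leaves the problems \<open>(A, left half)\<close> and
  \<open>(\<rho> A, right half)\<close>; any other function is Lipschitz on the first quarter at the scale of its
  values, which costs \<open>c X\<close> and leaves three quarters of the interval. In both cases
  the values of \<open>X\<close> of the remaining problems add up to a fixed fraction of \<open>X\<close>.
\<close>

lemma antimono_root_concave_covered:
  fixes \<alpha> r :: real
  assumes \<alpha>: "0 < \<alpha>" and r: "1 \<le> r"
  obtains K where "0 \<le> K" "\<And>A a b Y Z. 0 < A \<Longrightarrow> a < b \<Longrightarrow> Y = A powr r * (b - a) \<Longrightarrow> 0 < Z \<Longrightarrow>
    covered (Lr_bracket r {a..b} (2 * sqrt (Z * Y))) {a..b} (exp (K * (Y / Z) powr (1 / (4 * r)))) (antimono_root_concave \<alpha> A a b)"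
proof -
  define q where "q = 1 / (4 * r)"
  have q: "0 < q" using r by (simp add: q_def)
  obtain \<rho> \<theta> where \<rho>: "0 < \<rho>" "\<rho> \<le> 1" and \<theta>: "\<theta> < 1" "(3 / 4) powr q \<le> \<theta>"
    "(1 / 2) powr q + (\<rho> powr r * (1 / 2)) powr q \<le> \<theta>" and \<rho>2: "1 + sqrt (\<rho> powr r) \<le> sqrt 2"
    using splitting_ratio[OF r] unfolding q_def by blast
  obtain c where c: "0 \<le> c" "\<And>A a b X. 0 < A \<Longrightarrow> a < b \<Longrightarrow> 1 \<le> X \<Longrightarrow>
    covered (nonneg_sup_bracket (A / X\<^sup>2)) {a..a + (b - a) / 4} (exp (c * X))
      {f \<in> antimono_root_concave \<alpha> A a b. \<rho> * A \<le> f ((a + b) / 2)}"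
    using antimono_root_concave_comparable_covered[OF \<alpha> \<rho>] by blast
  \<comment> \<open>The solution of \<open>K * \<theta> + c + 1 = K\<close>: what the remaining
    problems cost, the Lipschitz quarter, and one unit for the union of the two cases.\<close>
  define K where "K = (c + 1) / (1 - \<theta>)"
  have K: "0 \<le> K" "K * \<theta> + c + 1 = K" using c(1) \<theta>(1) by (auto simp: K_def field_simps)
  \<comment> \<open>The exponent \<open>n\<close> is a termination measure: each remaining problem
    has at most three quarters of \<open>Y\<close>.\<close>
  have main: "covered (Lr_bracket r {a..b} (2 * sqrt (Z * Y))) {a..b} (exp (K * (Y / Z) powr q)) (antimono_root_concave \<alpha> A a b)"
    if "0 < A" "a < b" "Y = A powr r * (b - a)" "0 < Z" "Y \<le> Z * (4 / 3) ^ n" for A a b Y Z n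
    using that
  proof (induction n arbitrary: A a b Y)
    case 0
    then have Y: "0 \<le> Y" "Y \<le> Z" by auto
    have "Y = sqrt (Y * Y)" using Y by simp
    also have "\<dots> \<le> sqrt (Z * Y)" using Y by (intro real_sqrt_le_mono mult_right_mono)
    also have "\<dots> \<le> 2 * sqrt (Z * Y)" using Y 0 by simp
    finally show ?case
      using 0 K r by (intro trivial_covered[of A]) (auto simp: antimono_root_concave_def)
  next
    case (Suc n)
    note IH = Suc.IH
    have A: "0 < A" and ab: "a < b" and Y: "Y = A powr r * (b - a)" and Z: "0 < Z" using Suc.prems by auto
    have Y0: "0 < Y" using A ab Y by simp
    have Yn: "3 / 4 * Y \<le> Z * (4 / 3) ^ n" using Suc.prems(5) by (simp add: field_simps)
    define X where "X = (Y / Z) powr q"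
    show ?case
    proof (cases "Y \<le> Z")
      case True
      have "Z * 1 \<le> Z * (4 / 3) ^ n" using Z by (intro mult_left_mono one_le_power) auto
      then show ?thesis using IH[OF A ab Y Z] True by simp
    next
      case False
      have X1: "1 \<le> X" unfolding X_def using False Z q by (intro ge_one_powr_ge_zero) auto
      \<comment> \<open>This is what ties \<open>X\<close> to \<open>Y / Z\<close>: uniform
        precision \<open>A / X^2\<close> on a quarter of the interval amounts to an integrated error
        of \<open>sqrt (Z * Y) / 4\<close>.\<close>
      have X4: "(1 / X\<^sup>2) powr r = sqrt (Z / Y)"
      proof -
        have "X\<^sup>2 = (Y / Z) powr (2 * q)"
          unfolding X_def using Y0 Z by (simp add: powr_powr mult.commute flip: powr_numeral)
        then have "1 / X\<^sup>2 = (Y / Z) powr (- (2 * q))" by (simp add: powr_minus_divide)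
        moreover have "- (2 * q) * r = - (1 / 2)" using r by (simp add: q_def)
        ultimately have "(1 / X\<^sup>2) powr r = (Y / Z) powr (- (1 / 2))" by (simp only: powr_powr)
        also have "\<dots> = 1 / sqrt (Y / Z)" using Y0 Z by (simp add: powr_minus_divide powr_half_sqrt)
        finally show ?thesis by (simp add: real_sqrt_divide)
      qed
      define m where "m = (a + b) / 2"
      define e where "e = a + (b - a) / 4"
      define F1 where "F1 = {f \<in> antimono_root_concave \<alpha> A a b. \<rho> * A \<le> f m}"
      define F2 where "F2 = {f \<in> antimono_root_concave \<alpha> A a b. f m \<le> \<rho> * A}"
      have am: "a < m" "m < b" "a < e" "e < b" using ab by (auto simp: m_def e_def field_simps)
      have S: "sqrt (Z * (u * Y)) = sqrt u * sqrt (Z * Y)" for u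
        by (simp add: real_sqrt_mult)
      have "covered (Lr_bracket r {a..b} (2 * sqrt (Z * Y))) {a..b} (exp (c * X + K * (3 / 4 * Y / Z) powr q)) F1"
      proof (rule covered_Lr_glue)
        show "covered (Lr_bracket r {a..e} (sqrt (Z * Y) / 4)) {a..e} (exp (c * X)) F1"
        proof (rule covered_mono[OF c(2)[OF A ab X1, folded e_def m_def, folded F1_def]])
          fix p assume p: "nonneg_sup_bracket (A / X\<^sup>2) p"
          have "(A / X\<^sup>2) powr r * (e - a) = (1 / X\<^sup>2) powr r * Y / 4"
            using A X1 by (simp add: e_def Y powr_divide)
          also have "\<dots> = sqrt (Z * Y) / 4"
            unfolding X4 using Y0 Z by (simp add: real_sqrt_divide real_sqrt_mult field_simps)
          finally show "Lr_bracket r {a..e} (sqrt (Z * Y) / 4) p"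
            using Lr_bracket_nonneg_sup_bracket[OF p, of a e r] am(3) r by (metis less_imp_le order_trans zero_le_one)
        qed auto
        show "covered (Lr_bracket r {e..b} (2 * sqrt (Z * (3 / 4 * Y)))) {e..b} (exp (K * (3 / 4 * Y / Z) powr q)) F1"
        proof (rule covered_mono[OF IH[OF A am(4) _ Z Yn]])
          show "3 / 4 * Y = A powr r * (b - e)" by (simp add: Y e_def field_simps)
          show "F1 \<subseteq> antimono_root_concave \<alpha> A e b"
          proof
            fix f assume "f \<in> F1"
            then have "f \<in> antimono_root_concave \<alpha> A a b" by (simp add: F1_def)
            then show "f \<in> antimono_root_concave \<alpha> A e b" by (rule antimono_root_concave_subset) (use am \<open>f \<in> antimono_root_concave \<alpha> A a b\<close> in \<open>auto simp: antimono_root_concave_def\<close>)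
          qed
        qed auto
        \<comment> \<open>The errors fit exactly: \<open>1 / 4 + 2 * (7 / 8) = 2\<close>.\<close>
        have "sqrt (3 / 4) \<le> 7 / 8" by (intro real_le_lsqrt) (auto simp: power2_eq_square)
        then have "(1 / 4 + 2 * sqrt (3 / 4)) * sqrt (Z * Y) \<le> 2 * sqrt (Z * Y)"
          using Y0 Z by (intro mult_right_mono) auto
        then show "sqrt (Z * Y) / 4 + 2 * sqrt (Z * (3 / 4 * Y)) \<le> 2 * sqrt (Z * Y)"
          unfolding S by (simp add: algebra_simps)
      qed (use Y0 Z am in \<open>auto simp: exp_add\<close>)
      moreover have "covered (Lr_bracket r {a..b} (2 * sqrt (Z * Y))) {a..b}
          (exp (K * (1 / 2 * Y / Z) powr q + K * (\<rho> powr r * (1 / 2) * Y / Z) powr q)) F2"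
      proof (rule covered_Lr_glue)
        have half: "1 / 2 * Y \<le> 3 / 4 * Y" using Y0 by simp
        have \<rho>r: "\<rho> powr r \<le> 1" using powr_mono2[of r \<rho> 1] \<rho> r by simp
        have half2: "\<rho> powr r * (1 / 2) * Y \<le> 3 / 4 * Y"
          using \<rho>r Y0 by (intro mult_right_mono) auto
        show "covered (Lr_bracket r {a..m} (2 * sqrt (Z * (1 / 2 * Y)))) {a..m} (exp (K * (1 / 2 * Y / Z) powr q)) F2"
        proof (rule covered_mono[OF IH[OF A am(1) _ Z order_trans[OF half Yn]]])
          show "1 / 2 * Y = A powr r * (m - a)" by (simp add: Y m_def field_simps)
          show "F2 \<subseteq> antimono_root_concave \<alpha> A a m"
          proof
            fix f assume "f \<in> F2"
            then have "f \<in> antimono_root_concave \<alpha> A a b" by (simp add: F2_def)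
            then show "f \<in> antimono_root_concave \<alpha> A a m" by (rule antimono_root_concave_subset) (use am \<open>f \<in> antimono_root_concave \<alpha> A a b\<close> in \<open>auto simp: antimono_root_concave_def\<close>)
          qed
        qed auto
        show "covered (Lr_bracket r {m..b} (2 * sqrt (Z * (\<rho> powr r * (1 / 2) * Y)))) {m..b}
            (exp (K * (\<rho> powr r * (1 / 2) * Y / Z) powr q)) F2"
        proof (rule covered_mono[OF IH[OF mult_pos_pos[OF \<rho>(1) A] am(2) _ Z order_trans[OF half2 Yn]]])
          show "\<rho> powr r * (1 / 2) * Y = (\<rho> * A) powr r * (b - m)"
            using \<rho> A by (simp add: Y m_def powr_mult field_simps)
          show "F2 \<subseteq> antimono_root_concave \<alpha> (\<rho> * A) m b"
          proof
            fix f assume "f \<in> F2"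
            then have f: "f \<in> antimono_root_concave \<alpha> A a b" "f m \<le> \<rho> * A" by (auto simp: F2_def)
            show "f \<in> antimono_root_concave \<alpha> (\<rho> * A) m b"
            proof (rule antimono_root_concave_subset[OF f(1)])
              fix x assume "x \<in> {m..b}"
              then have "f x \<le> f m" using f(1) am unfolding antimono_root_concave_def by (auto dest: monotone_onD[where x = m and y = x])
              then show "f x \<le> \<rho> * A" using f(2) by simp
            qed (use am in auto)
          qed
        qed auto
        have "2 * sqrt (Z * (1 / 2 * Y)) + 2 * sqrt (Z * (\<rho> powr r * (1 / 2) * Y)) =
            2 * sqrt (1 / 2) * (1 + sqrt (\<rho> powr r)) * sqrt (Z * Y)"
          unfolding S real_sqrt_mult by (simp add: algebra_simps)
        also have "\<dots> \<le> 2 * sqrt (1 / 2) * sqrt 2 * sqrt (Z * Y)"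
          using \<rho>2 Y0 Z by (intro mult_right_mono mult_left_mono) auto
        also have "\<dots> = 2 * sqrt (Z * Y)" by (simp add: real_sqrt_divide)
        finally show "2 * sqrt (Z * (1 / 2 * Y)) + 2 * sqrt (Z * (\<rho> powr r * (1 / 2) * Y)) \<le> 2 * sqrt (Z * Y)" .
      qed (use Y0 Z am \<rho> in \<open>auto simp: exp_add\<close>)
      ultimately have "covered (Lr_bracket r {a..b} (2 * sqrt (Z * Y))) {a..b}
          (exp (c * X + K * (3 / 4 * Y / Z) powr q) +
           exp (K * (1 / 2 * Y / Z) powr q + K * (\<rho> powr r * (1 / 2) * Y / Z) powr q)) (F1 \<union> F2)"
        by (rule covered_Un)
      then show ?thesis
      proof (rule covered_mono)
        show "antimono_root_concave \<alpha> A a b \<subseteq> F1 \<union> F2" by (auto simp: F1_def F2_def)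
        have P: "(u * Y / Z) powr q = u powr q * X" for u
          unfolding X_def by (simp add: powr_mult[symmetric])
        have "c * X + K * (3 / 4 * Y / Z) powr q \<le> c * X + K * (\<theta> * X)"
          unfolding P using \<theta> K X1 by (intro add_left_mono mult_left_mono mult_right_mono) auto
        also have "\<dots> = (K * \<theta> + c + 1) * X - X" by (simp add: algebra_simps)
        also have "\<dots> = K * X - X" unfolding K(2) ..
        finally have 1: "c * X + K * (3 / 4 * Y / Z) powr q \<le> K * X - 1" using X1 by simp
        have "K * (1 / 2 * Y / Z) powr q + K * (\<rho> powr r * (1 / 2) * Y / Z) powr q =
            K * (((1 / 2) powr q + (\<rho> powr r * (1 / 2)) powr q) * X)"
          unfolding P by (simp add: algebra_simps)
        also have "\<dots> \<le> K * (\<theta> * X)"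
          using \<theta> K X1 by (intro mult_left_mono mult_right_mono) auto
        also have "\<dots> \<le> (K * \<theta> + c + 1) * X - X" using c(1) X1 by (simp add: algebra_simps)
        also have "\<dots> = K * X - X" unfolding K(2) ..
        finally have 2: "K * (1 / 2 * Y / Z) powr q + K * (\<rho> powr r * (1 / 2) * Y / Z) powr q \<le> K * X - 1"
          using X1 by simp
        show "exp (c * X + K * (3 / 4 * Y / Z) powr q) +
           exp (K * (1 / 2 * Y / Z) powr q + K * (\<rho> powr r * (1 / 2) * Y / Z) powr q) \<le> exp (K * (Y / Z) powr q)"
          using exp_sum_le[OF 1 2] by (simp add: X_def)
      qed
    qed
  qed
  show ?thesis
  proof (rule that[OF K(1)])
    fix A a b Y Z :: real
    assume *: "0 < A" "a < b" "Y = A powr r * (b - a)" "0 < Z"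
    obtain n where "Y / Z < (4 / 3) ^ n" using real_arch_pow[of "4 / 3"] by auto
    then have "Y \<le> Z * (4 / 3) ^ n" using *(4) by (simp add: field_simps)
    from main[OF * this]
    show "covered (Lr_bracket r {a..b} (2 * sqrt (Z * Y))) {a..b} (exp (K * (Y / Z) powr (1 / (4 * r)))) (antimono_root_concave \<alpha> A a b)"
      by (simp add: q_def)
  qed
qed

section \<open>Unimodal functions and the whole line\<close>

definition bounded_root_concave :: "real \<Rightarrow> real \<Rightarrow> real \<Rightarrow> real \<Rightarrow> (real \<Rightarrow> real) set" where
  "bounded_root_concave \<alpha> A a b = {f. (\<forall>x\<in>{a..b}. 0 \<le> f x \<and> f x \<le> A) \<and> root_concave \<alpha> {a..b} f}"

text \<open>Quasiconcavity: a convex combination of the negative powers is at most the larger one,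
  which is the negative power of the minimum. Zero values, where the convex function is infinite,
  are trivial.\<close>

lemma root_concave_min_le:
  assumes "root_concave \<alpha> {a..b} f" "0 < \<alpha>" "\<And>x. x \<in> {a..b} \<Longrightarrow> 0 \<le> f x"
    "a \<le> x" "x \<le> z" "z \<le> y" "y \<le> b"
  shows "min (f x) (f y) \<le> f z"
proof (cases "x = y \<or> f x = 0 \<or> f y = 0")
  case True
  have "0 \<le> f z" using assms by auto
  then show ?thesis using True assms(5,6) by (metis antisym min.cobounded1 min_le_iff_disj)
next
  case False
  define t where "t = (z - x) / (y - x)"
  have xy: "x < y" using False assms(5,6) by auto
  then have t: "0 \<le> t" "t \<le> 1" using assms(5,6) by (auto simp: t_def)
  have "t * (y - x) = z - x" using xy by (simp add: t_def)
  then have z: "z = (1 - t) * x + t * y" by (simp add: algebra_simps)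
  have pos: "0 < f x" "0 < f y" using False assms by (auto simp: order.strict_iff_order)
  define M where "M = min (f x) (f y)"
  have M: "0 < M" "M \<le> f x" "M \<le> f y" using pos by (auto simp: M_def)
  have mem: "x \<in> {a..b}" "y \<in> {a..b}" using assms xy by auto
  have fz: "0 < f z" and le: "f z powr (- 1 / \<alpha>) \<le> (1 - t) * f x powr (- 1 / \<alpha>) + t * f y powr (- 1 / \<alpha>)"
    using root_concaveD[OF assms(1) mem t pos] unfolding z[symmetric] by auto
  have "f x powr (- 1 / \<alpha>) \<le> M powr (- 1 / \<alpha>)" "f y powr (- 1 / \<alpha>) \<le> M powr (- 1 / \<alpha>)"
    by (intro powr_mono2'; use M assms(2) in simp)+
  then have "(1 - t) * f x powr (- 1 / \<alpha>) + t * f y powr (- 1 / \<alpha>)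
      \<le> (1 - t) * M powr (- 1 / \<alpha>) + t * M powr (- 1 / \<alpha>)"
    using t by (intro add_mono mult_left_mono) auto
  also have "\<dots> = M powr (- 1 / \<alpha>)" by (simp add: algebra_simps)
  finally have "f z powr (- 1 / \<alpha>) \<le> M powr (- 1 / \<alpha>)" using le by simp
  moreover have "M powr (- 1 / \<alpha>) < f z powr (- 1 / \<alpha>)" if "f z < M"
    using fz that assms(2) by (intro powr_less_mono2_neg) auto
  ultimately show ?thesis unfolding M_def[symmetric] by (meson not_le)
qed

text \<open>If \<open>f\<close> drops strictly somewhere to the left of \<open>m\<close>,
  quasiconcavity forbids any later rise, so \<open>f\<close> decreases on the right half.\<close>

lemma root_concave_monotone_half:
  assumes "root_concave \<alpha> {a..b} f" "0 < \<alpha>" "\<And>x. x \<in> {a..b} \<Longrightarrow> 0 \<le> f x" "a \<le> m" "m \<le> b"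
  shows "antimono_on {m..b} f \<or> mono_on {a..m} f"
proof (rule disjCI)
  assume "\<not> mono_on {a..m} f"
  then obtain u v where uv: "a \<le> u" "u \<le> v" "v \<le> m" "f v < f u"
    by (auto simp: monotone_on_def not_le)
  show "antimono_on {m..b} f"
  proof (rule monotone_onI)
    fix x y assume xy: "x \<in> {m..b}" "y \<in> {m..b}" "x \<le> y"
    have q: "min (f p) (f r) \<le> f z" if "a \<le> p" "p \<le> z" "z \<le> r" "r \<le> b" for p z r
      by (rule root_concave_min_le[OF assms(1-3) that])
    have "min (f u) (f x) \<le> f v" using q[of u v x] uv xy by auto
    then have "f x \<le> f v" using uv(4) by auto
    moreover have "min (f u) (f y) \<le> f x" using q[of u x y] uv xy by auto
    ultimately show "f y \<le> f x" using uv(4) by auto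
  qed
qed

lemma root_concave_reflect:
  assumes "root_concave \<alpha> S f"
  shows "root_concave \<alpha> {x. - x \<in> S} (\<lambda>x. f (- x))"
proof -
  have eq: "- ((1 - t) * x + t * y) = (1 - t) * (- x) + t * (- y)" for t x y :: real
    by (simp add: algebra_simps)
  show ?thesis
    unfolding root_concave_def eq
  proof (intro ballI allI impI)
    fix x y t :: real assume xy: "x \<in> {x. - x \<in> S}" "y \<in> {x. - x \<in> S}"
      and t: "0 \<le> t \<and> t \<le> 1 \<and> 0 < f (- x) \<and> 0 < f (- y)"
    have "- x \<in> S" "- y \<in> S" using xy by auto
    with t show "0 < f ((1 - t) * - x + t * - y) \<and>
        f ((1 - t) * - x + t * - y) powr (- 1 / \<alpha>)
          \<le> (1 - t) * f (- x) powr (- 1 / \<alpha>) + t * f (- y) powr (- 1 / \<alpha>)"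
      using root_concaveD[OF assms, of "- x" "- y" t] by blast
  qed
qed

lemma Lr_bracket_reflect:
  assumes "Lr_bracket r I E b" "I \<in> sets borel"
  shows "Lr_bracket r {x. - x \<in> I} E (\<lambda>x. fst b (- x), \<lambda>x. snd b (- x))"
proof -
  have [measurable]: "fst b \<in> borel_measurable borel" "snd b \<in> borel_measurable borel" "I \<in> sets borel"
    using assms by (auto simp: Lr_bracket_def)
  let ?F = "\<lambda>x. ennreal ((snd b x - fst b x) powr r) * indicator I x"
  have "(\<integral>\<^sup>+x. ?F x \<partial>lborel) = (\<integral>\<^sup>+x. ?F (0 + (- 1) * x) \<partial>lborel)"
    by (subst nn_integral_real_affine[of _ "- 1" 0]) auto
  also have "\<dots> = (\<integral>\<^sup>+x. ennreal ((snd b (- x) - fst b (- x)) powr r) * indicator {x. - x \<in> I} x \<partial>lborel)"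
    by (intro nn_integral_cong) (auto simp: indicator_def)
  finally show ?thesis using assms(1) unfolding Lr_bracket_def by auto
qed

text \<open>Reduces increasing pieces to decreasing ones, and the left tail to the right
  tail.\<close>

lemma covered_reflect:
  assumes "covered (Lr_bracket r I E) I N F" "I \<in> sets borel" "\<And>f. f \<in> F' \<Longrightarrow> (\<lambda>x. f (- x)) \<in> F"
  shows "covered (Lr_bracket r {x. - x \<in> I} E) {x. - x \<in> I} N F'"
proof (rule covered_map[OF assms(1), where T = "\<lambda>b. (\<lambda>x. fst b (- x), \<lambda>x. snd b (- x))"])
  fix f assume "f \<in> F'"
  then show "\<exists>g\<in>F. \<forall>b. Lr_bracket r I E b \<longrightarrow> encloses I b g \<longrightarrow>
      encloses {x. - x \<in> I} (\<lambda>x. fst b (- x), \<lambda>x. snd b (- x)) f"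
    by (intro bexI[OF _ assms(3)]) (force simp: encloses_def)+
qed (use Lr_bracket_reflect assms(2) in auto)

lemma bounded_root_concave_subset:
  assumes "f \<in> bounded_root_concave \<alpha> A a b" "a \<le> c" "d \<le> b"
  shows "f \<in> bounded_root_concave \<alpha> A c d"
proof -
  have "{c..d} \<subseteq> {a..b}" using assms by auto
  then show ?thesis using assms unfolding bounded_root_concave_def by (auto intro: root_concave_subset)
qed

text \<open>The mode is never located: bisection settles the half on which the function is monotone
  and recurses on the other. As only one part is passed on, the exponents form a geometric series
  with ratio \<open>(1 / 2) powr q\<close>; the \<open>+ 1\<close> in \<open>K\<close> again pays
  for the union of the two cases.\<close>

lemma bounded_root_concave_covered:
  fixes \<alpha> r :: real
  assumes \<alpha>: "0 < \<alpha>" and r: "1 \<le> r"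
  obtains K where "0 \<le> K" "\<And>A a b Y Z. 0 < A \<Longrightarrow> a < b \<Longrightarrow> Y = A powr r * (b - a) \<Longrightarrow> 0 < Z \<Longrightarrow>
    covered (Lr_bracket r {a..b} (6 * sqrt (Z * Y))) {a..b} (exp (K * (Y / Z) powr (1 / (4 * r)))) (bounded_root_concave \<alpha> A a b)"
proof -
  define q where "q = 1 / (4 * r)"
  have q: "0 < q" using r by (simp add: q_def)
  obtain L where L: "0 \<le> L" "\<And>A a b Y Z. 0 < A \<Longrightarrow> a < b \<Longrightarrow> Y = A powr r * (b - a) \<Longrightarrow> 0 < Z \<Longrightarrow>
    covered (Lr_bracket r {a..b} (2 * sqrt (Z * Y))) {a..b} (exp (L * (Y / Z) powr q)) (antimono_root_concave \<alpha> A a b)"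
    using antimono_root_concave_covered[OF assms] unfolding q_def by blast
  define \<theta> :: real where "\<theta> = (1 / 2) powr q"
  have "(1 / 2 :: real) powr q < 1 powr q" by (intro powr_less_mono2; use q in simp)
  then have \<theta>: "0 \<le> \<theta>" "\<theta> < 1" by (auto simp: \<theta>_def)
  define K where "K = (L + 1) / (1 - \<theta>)"
  have K: "0 \<le> K" "K * \<theta> + L + 1 = K" using L(1) \<theta> by (auto simp: K_def field_simps)
  have main: "covered (Lr_bracket r {a..b} (6 * sqrt (Z * Y))) {a..b} (exp (K * (Y / Z) powr q)) (bounded_root_concave \<alpha> A a b)"
    if "0 < A" "a < b" "Y = A powr r * (b - a)" "0 < Z" "Y \<le> Z * 2 ^ n" for A a b Y Z n
    using that
  proof (induction n arbitrary: a b Y)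
    case 0
    then have Y: "0 \<le> Y" "Y \<le> Z" by auto
    have "Y = sqrt (Y * Y)" using Y by simp
    also have "\<dots> \<le> sqrt (Z * Y)" using Y by (intro real_sqrt_le_mono mult_right_mono)
    also have "\<dots> \<le> 6 * sqrt (Z * Y)" using Y 0 by simp
    finally show ?case
      using 0 K r by (intro trivial_covered[of A]) (auto simp: bounded_root_concave_def)
  next
    case (Suc n)
    note IH = Suc.IH
    have A: "0 < A" and ab: "a < b" and Y: "Y = A powr r * (b - a)" and Z: "0 < Z" using Suc.prems by auto
    have Y0: "0 < Y" using A ab Y by simp
    have Yn: "1 / 2 * Y \<le> Z * 2 ^ n" using Suc.prems(5) by simp
    define X where "X = (Y / Z) powr q"
    show ?case
    proof (cases "Y \<le> Z")
      case True
      have "Z * 1 \<le> Z * 2 ^ n" using Z by (intro mult_left_mono one_le_power) auto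
      then show ?thesis using IH[OF A ab Y Z] True by simp
    next
      case False
      have X1: "1 \<le> X" unfolding X_def using False Z q by (intro ge_one_powr_ge_zero) auto
      define m where "m = (a + b) / 2"
      define F1 where "F1 = {f \<in> bounded_root_concave \<alpha> A a b. antimono_on {m..b} f}"
      define F2 where "F2 = {f \<in> bounded_root_concave \<alpha> A a b. mono_on {a..m} f}"
      have am: "a < m" "m < b" using ab by (auto simp: m_def)
      have P: "(1 / 2 * Y / Z) powr q = \<theta> * X"
        unfolding X_def \<theta>_def powr_mult[symmetric] by simp
      have Ym: "1 / 2 * Y = A powr r * (m - a)" "1 / 2 * Y = A powr r * (b - m)"
        by (simp_all add: Y m_def field_simps)
      note IH1 = IH[OF A am(1) Ym(1) Z Yn, unfolded P]
      note IH2 = IH[OF A am(2) Ym(2) Z Yn, unfolded P]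
      note D = L(2)[OF A am(2) Ym(2) Z, unfolded P]
      have "- m < - a" "1 / 2 * Y = A powr r * (- a - - m)" using am Ym by simp_all
      note D' = L(2)[OF A this Z, unfolded P]
      have D': "covered (Lr_bracket r {a..m} (2 * sqrt (Z * (1 / 2 * Y)))) {a..m} (exp (L * (\<theta> * X))) F2"
      proof -
        have "{x. - x \<in> {- m..- a}} = {a..m}" by auto
        moreover have "(\<lambda>x. f (- x)) \<in> antimono_root_concave \<alpha> A (- m) (- a)" if "f \<in> F2" for f
        proof -
          have f: "f \<in> bounded_root_concave \<alpha> A a m" "mono_on {a..m} f" using that bounded_root_concave_subset[of f \<alpha> A a b a m] am by (auto simp: F2_def)
          have "{x. - x \<in> {a..m}} = {- m..- a}" by auto
          then have "root_concave \<alpha> {- m..- a} (\<lambda>x. f (- x))"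
            using root_concave_reflect[of \<alpha> "{a..m}" f] f(1) unfolding bounded_root_concave_def by simp
          moreover have "antimono_on {- m..- a} (\<lambda>x. f (- x))"
            by (rule monotone_onI, rule monotone_onD[OF f(2)]) auto
          ultimately show ?thesis using f(1) unfolding antimono_root_concave_def bounded_root_concave_def by auto
        qed
        ultimately show ?thesis using covered_reflect[OF D', of F2] by simp
      qed
      have sq: "sqrt (Z * (1 / 2 * Y)) = sqrt (1 / 2) * sqrt (Z * Y)"
        unfolding real_sqrt_mult by simp
      \<comment> \<open>The recursive half brings 6 and the monotone half 2 times
        \<open>sqrt (1 / 2)\<close>, and \<open>8 * (3 / 4) = 6\<close>.\<close>
      have "sqrt (1 / 2) \<le> 3 / 4" by (intro real_le_lsqrt) (auto simp: power2_eq_square)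
      then have "8 * sqrt (1 / 2) * sqrt (Z * Y) \<le> 6 * sqrt (Z * Y)"
        using Y0 Z by (intro mult_right_mono) auto
      then have E: "6 * sqrt (Z * (1 / 2 * Y)) + 2 * sqrt (Z * (1 / 2 * Y)) \<le> 6 * sqrt (Z * Y)"
        unfolding sq by simp
      have "covered (Lr_bracket r {a..b} (6 * sqrt (Z * Y))) {a..b} (exp (K * (\<theta> * X)) * exp (L * (\<theta> * X))) F1"
      proof (rule covered_Lr_glue)
        show "covered (Lr_bracket r {a..m} (6 * sqrt (Z * (1 / 2 * Y)))) {a..m} (exp (K * (\<theta> * X))) F1"
          by (rule covered_mono[OF IH1]) (use bounded_root_concave_subset[of _ \<alpha> A a b a m] am in \<open>auto simp: F1_def\<close>)
        show "covered (Lr_bracket r {m..b} (2 * sqrt (Z * (1 / 2 * Y)))) {m..b} (exp (L * (\<theta> * X))) F1"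
          by (rule covered_mono[OF D])
            (use bounded_root_concave_subset[of _ \<alpha> A a b m b] am in \<open>auto simp: F1_def antimono_root_concave_def bounded_root_concave_def\<close>)
      qed (use Y0 Z am E in auto)
      moreover have "covered (Lr_bracket r {a..b} (6 * sqrt (Z * Y))) {a..b} (exp (L * (\<theta> * X)) * exp (K * (\<theta> * X))) F2"
      proof (rule covered_Lr_glue[OF D'])
        show "covered (Lr_bracket r {m..b} (6 * sqrt (Z * (1 / 2 * Y)))) {m..b} (exp (K * (\<theta> * X))) F2"
          by (rule covered_mono[OF IH2]) (use bounded_root_concave_subset[of _ \<alpha> A a b m b] am in \<open>auto simp: F2_def\<close>)
      qed (use Y0 Z am E in auto)
      ultimately have "covered (Lr_bracket r {a..b} (6 * sqrt (Z * Y))) {a..b}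
          (exp (K * (\<theta> * X)) * exp (L * (\<theta> * X)) + exp (L * (\<theta> * X)) * exp (K * (\<theta> * X))) (F1 \<union> F2)"
        by (rule covered_Un)
      then show ?thesis
      proof (rule covered_mono)
        show "bounded_root_concave \<alpha> A a b \<subseteq> F1 \<union> F2"
        proof
          fix f assume f: "f \<in> bounded_root_concave \<alpha> A a b"
          then have "antimono_on {m..b} f \<or> mono_on {a..m} f"
            using am by (intro root_concave_monotone_half[OF _ \<alpha>]) (auto simp: bounded_root_concave_def)
          then show "f \<in> F1 \<union> F2" using f by (auto simp: F1_def F2_def)
        qed
        have "L * (\<theta> * X) \<le> L * (1 * X)"
          using \<theta> L(1) X1 by (intro mult_left_mono mult_right_mono) auto
        then have "K * (\<theta> * X) + L * (\<theta> * X) \<le> (K * \<theta> + L + 1) * X - X" by (simp add: algebra_simps)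
        also have "\<dots> = K * X - X" unfolding K(2) ..
        finally have 1: "K * (\<theta> * X) + L * (\<theta> * X) \<le> K * X - 1" using X1 by simp
        show "exp (K * (\<theta> * X)) * exp (L * (\<theta> * X)) + exp (L * (\<theta> * X)) * exp (K * (\<theta> * X)) \<le> exp (K * (Y / Z) powr q)"
          using exp_sum_le[OF 1 1] by (simp add: X_def exp_add mult.commute)
      qed
    qed
  qed
  show ?thesis
  proof (rule that[OF K(1)])
    fix A a b Y Z :: real
    assume *: "0 < A" "a < b" "Y = A powr r * (b - a)" "0 < Z"
    obtain n where "Y / Z < 2 ^ n" using real_arch_pow[of 2] by auto
    then have "Y \<le> Z * 2 ^ n" using *(4) by (simp add: field_simps)
    from main[OF * this]
    show "covered (Lr_bracket r {a..b} (6 * sqrt (Z * Y))) {a..b} (exp (K * (Y / Z) powr (1 / (4 * r)))) (bounded_root_concave \<alpha> A a b)"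
      by (simp add: q_def)
  qed
qed

section \<open>Polynomially decaying tails\<close>

definition tail_root_concave :: "real \<Rightarrow> real \<Rightarrow> real \<Rightarrow> (real \<Rightarrow> real) set" where
  "tail_root_concave \<alpha> A R = {f. (\<forall>x\<ge>R. 0 \<le> f x \<and> f x \<le> A * x powr (- \<alpha>)) \<and> root_concave \<alpha> {R..} f}"

text \<open>The terminal bracket, from zero to the envelope, for a tail that is cut no further;
  \<open>1 < \<alpha> * r\<close> makes its integral finite.\<close>

lemma Lr_bracket_powr_tail:
  assumes "0 \<le> A" "0 < R" "0 < r" "1 < \<alpha> * r"
  shows "Lr_bracket r {R..} (A powr r * R powr (1 - \<alpha> * r) / (\<alpha> * r - 1)) (\<lambda>x. 0, \<lambda>x. A * x powr (- \<alpha>))"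
proof -
  have "((\<lambda>x. A powr r * x powr (- \<alpha> * r)) has_integral
      A powr r * (- (R powr (- \<alpha> * r + 1)) / (- \<alpha> * r + 1))) {R..}"
    by (intro has_integral_mult_right has_integral_powr_to_inf) (use assms in auto)
  also have "A powr r * (- (R powr (- \<alpha> * r + 1)) / (- \<alpha> * r + 1)) = A powr r * R powr (1 - \<alpha> * r) / (\<alpha> * r - 1)"
    using assms by (simp add: field_simps)
  finally have "(\<integral>\<^sup>+x. ennreal (A powr r * x powr (- \<alpha> * r)) * indicator {R..} x \<partial>lborel)
      = ennreal (A powr r * R powr (1 - \<alpha> * r) / (\<alpha> * r - 1))"
    by (intro nn_integral_has_integral_lebesgue') auto
  then show ?thesis
    unfolding Lr_bracket_def using assms by (simp add: powr_mult powr_powr)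
qed

text \<open>Replacing \<open>R\<close> by \<open>2 * R\<close> multiplies \<open>Y\<close> by
  \<open>\<eta> = 2 powr (1 - \<alpha> * r)\<close>, which is less than one, so the dyadic pieces
  give geometric series both for the errors and for the exponents. No case distinction occurs here,
  hence \<open>K * \<eta> powr q + L = K\<close> without an extra unit.\<close>

lemma tail_root_concave_covered:
  fixes \<alpha> r :: real
  assumes \<alpha>: "0 < \<alpha>" and r: "1 \<le> r" and \<alpha>r: "1 < \<alpha> * r"
  obtains C K where "0 \<le> C" "0 \<le> K" "\<And>A R Y Z. 0 < A \<Longrightarrow> 0 < R \<Longrightarrow> Y = A powr r * R powr (1 - \<alpha> * r) \<Longrightarrow>
    0 < Z \<Longrightarrow> covered (Lr_bracket r {R..} (C * sqrt (Z * Y))) {R..} (exp (K * (Y / Z) powr (1 / (4 * r)))) (tail_root_concave \<alpha> A R)"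
proof -
  define q where "q = 1 / (4 * r)"
  have q: "0 < q" using r by (simp add: q_def)
  obtain L where L: "0 \<le> L" "\<And>A a b Y Z. 0 < A \<Longrightarrow> a < b \<Longrightarrow> Y = A powr r * (b - a) \<Longrightarrow> 0 < Z \<Longrightarrow>
    covered (Lr_bracket r {a..b} (6 * sqrt (Z * Y))) {a..b} (exp (L * (Y / Z) powr q)) (bounded_root_concave \<alpha> A a b)"
    using bounded_root_concave_covered[OF \<alpha> r] unfolding q_def by blast
  define \<eta> :: real where "\<eta> = 2 powr (1 - \<alpha> * r)"
  have \<eta>: "0 < \<eta>" "\<eta> < 1" using powr_less_mono[of "1 - \<alpha> * r" 0 2] \<alpha>r by (auto simp: \<eta>_def)
  have \<eta>q: "0 \<le> \<eta> powr q" "\<eta> powr q < 1" using powr_less_mono2[of q \<eta> 1] \<eta> q by auto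
  have s\<eta>: "0 \<le> sqrt \<eta>" "sqrt \<eta> < 1" using \<eta> by auto
  \<comment> \<open>The first summand makes \<open>6 + C * sqrt \<eta> \<le> C\<close>, the error
    recursion; the second accommodates the terminal bracket.\<close>
  define C where "C = 6 / (1 - sqrt \<eta>) + 1 / (\<alpha> * r - 1)"
  have C0: "6 / (1 - sqrt \<eta>) \<ge> 0" "1 / (\<alpha> * r - 1) \<ge> 0" using s\<eta> \<alpha>r by auto
  have "6 = 6 / u * u" if "u \<noteq> 0" for u :: real using that by simp
  from this[of "1 - sqrt \<eta>"] have "6 = 6 / (1 - sqrt \<eta>) * (1 - sqrt \<eta>)" using s\<eta>(2) by linarith
  also have "\<dots> \<le> C * (1 - sqrt \<eta>)" using s\<eta> C0 by (intro mult_right_mono) (auto simp: C_def)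
  finally have "6 + C * sqrt \<eta> \<le> C" by (simp add: algebra_simps)
  moreover have "0 \<le> C" "1 / (\<alpha> * r - 1) \<le> C" using C0 by (auto simp: C_def)
  ultimately have C: "0 \<le> C" "1 / (\<alpha> * r - 1) \<le> C" "6 + C * sqrt \<eta> \<le> C" by auto
  define K where "K = L / (1 - \<eta> powr q)"
  have K: "0 \<le> K" "K * \<eta> powr q + L = K" using L(1) \<eta>q by (auto simp: K_def field_simps)
  have main: "covered (Lr_bracket r {R..} (C * sqrt (Z * Y))) {R..} (exp (K * (Y / Z) powr q)) (tail_root_concave \<alpha> A R)"
    if "0 < A" "0 < R" "Y = A powr r * R powr (1 - \<alpha> * r)" "0 < Z" "Y * \<eta> ^ n \<le> Z" for A R Y Z n
    using that
  proof (induction n arbitrary: R Y)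
    case 0
    then have Y: "0 \<le> Y" "Y \<le> Z" by auto
    have "Y / (\<alpha> * r - 1) = 1 / (\<alpha> * r - 1) * sqrt (Y * Y)" using Y by simp
    also have "\<dots> \<le> C * sqrt (Z * Y)"
      using Y C \<alpha>r by (intro mult_mono real_sqrt_le_mono) auto
    finally have "Lr_bracket r {R..} (C * sqrt (Z * Y)) (\<lambda>x. 0, \<lambda>x. A * x powr (- \<alpha>))"
      using Lr_bracket_powr_tail[of A R r \<alpha>] 0 \<alpha>r r Lr_bracket_mono by auto
    then show ?case
      by (rule covered_single) (use K in \<open>auto simp: encloses_def tail_root_concave_def\<close>)
  next
    case (Suc n)
    note A = Suc.prems(1) and R = Suc.prems(2) and Y = Suc.prems(3) and Z = Suc.prems(4)
    have Y0: "0 < Y" using A R Y by simp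
    define X where "X = (Y / Z) powr q"
    define B where "B = A * R powr (- \<alpha>)"
    have B: "0 < B" using A R by (simp add: B_def)
    \<comment> \<open>On \<open>[R, 2 * R]\<close> the envelope is at most its value
      \<open>B\<close> at \<open>R\<close>, and the trivial bracket \<open>[0, B]\<close> there has
      r-th power size exactly \<open>Y\<close>.\<close>
    have YB: "Y = B powr r * (2 * R - R)"
    proof -
      have "B powr r = A powr r * R powr (- \<alpha> * r)" by (simp only: B_def powr_mult powr_powr)
      moreover have "R powr (1 - \<alpha> * r) = R * R powr (- \<alpha> * r)"
        using R powr_add[of R 1 "- \<alpha> * r"] by simp
      ultimately show ?thesis by (simp add: Y)
    qed
    have Y2: "Y * \<eta> = A powr r * (2 * R) powr (1 - \<alpha> * r)"
      by (simp add: Y \<eta>_def powr_mult)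
    have sub: "f \<in> bounded_root_concave \<alpha> B R (2 * R)" if "f \<in> tail_root_concave \<alpha> A R" for f
    proof -
      have "f x \<le> B" if "x \<in> {R..2 * R}" for x
      proof -
        have "f x \<le> A * x powr (- \<alpha>)" using \<open>f \<in> tail_root_concave \<alpha> A R\<close> that by (auto simp: tail_root_concave_def)
        also have "\<dots> \<le> B" unfolding B_def using that A R \<alpha> by (intro mult_left_mono powr_mono2') auto
        finally show ?thesis .
      qed
      then show ?thesis using that by (auto simp: tail_root_concave_def bounded_root_concave_def intro: root_concave_subset)
    qed
    have P: "(Y * \<eta> / Z) powr q = \<eta> powr q * X"
      unfolding X_def powr_mult[symmetric] by (simp add: mult.commute)
    show ?case
    proof (rule covered_Lr_glue)
      show "covered (Lr_bracket r {R..2 * R} (6 * sqrt (Z * Y))) {R..2 * R} (exp (L * X)) (tail_root_concave \<alpha> A R)"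
        unfolding X_def by (rule covered_mono[OF L(2)[OF B _ YB Z]]) (use sub R in auto)
      have "Y * \<eta> * \<eta> ^ n \<le> Z" using Suc.prems(5) by (simp add: mult.assoc)
      then show "covered (Lr_bracket r {2 * R..} (C * sqrt (Z * (Y * \<eta>)))) {2 * R..} (exp (K * (\<eta> powr q * X))) (tail_root_concave \<alpha> A R)"
        unfolding P[symmetric]
        by (intro covered_mono[OF Suc.IH[OF A _ Y2 Z]])
          (use R in \<open>auto simp: tail_root_concave_def intro: root_concave_subset\<close>)
      have "6 * sqrt (Z * Y) + C * sqrt (Z * (Y * \<eta>)) = (6 + C * sqrt \<eta>) * sqrt (Z * Y)"
        unfolding real_sqrt_mult by (simp add: algebra_simps)
      also have "\<dots> \<le> C * sqrt (Z * Y)" using C Y0 Z by (intro mult_right_mono) auto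
      finally show "6 * sqrt (Z * Y) + C * sqrt (Z * (Y * \<eta>)) \<le> C * sqrt (Z * Y)" .
      have "L * X + K * (\<eta> powr q * X) = (K * \<eta> powr q + L) * X" by (simp add: algebra_simps)
      also have "\<dots> = K * X" unfolding K(2) ..
      finally show "exp (L * X) * exp (K * (\<eta> powr q * X)) \<le> exp (K * (Y / Z) powr q)"
        by (simp add: exp_add[symmetric] X_def)
    qed (use Y0 Z C \<eta> in auto)
  qed
  show ?thesis
  proof (rule that[OF C(1) K(1)])
    fix A R Y Z :: real
    assume *: "0 < A" "0 < R" "Y = A powr r * R powr (1 - \<alpha> * r)" "0 < Z"
    then have Y0: "0 < Y" by simp
    obtain n where "\<eta> ^ n < Z / Y" using real_arch_pow_inv[of "Z / Y" \<eta>] \<eta> *(4) Y0 by auto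
    then have "Y * \<eta> ^ n \<le> Z" using Y0 by (simp add: field_simps)
    from main[OF * this]
    show "covered (Lr_bracket r {R..} (C * sqrt (Z * Y))) {R..} (exp (K * (Y / Z) powr (1 / (4 * r)))) (tail_root_concave \<alpha> A R)"
      by (simp add: q_def)
  qed
qed

section \<open>The whole line\<close>

definition decaying :: "real \<Rightarrow> real \<Rightarrow> (real \<Rightarrow> real) set" where
  "decaying \<alpha> A = {f. (\<forall>x. 0 \<le> f x \<and> f x \<le> A \<and> (1 \<le> \<bar>x\<bar> \<longrightarrow> f x \<le> A * \<bar>x\<bar> powr (- \<alpha>))) \<and>
     root_concave \<alpha> UNIV f}"

lemma decaying_covered:
  fixes \<alpha> r A :: real
  assumes \<alpha>: "0 < \<alpha>" and r: "1 \<le> r" and \<alpha>r: "1 < \<alpha> * r" and A: "0 < A"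
  obtains K where "\<And>\<epsilon>. 0 < \<epsilon> \<Longrightarrow>
    covered (Lr_bracket r UNIV (\<epsilon> powr r)) UNIV (exp (K * \<epsilon> powr (- 1 / 2))) (decaying \<alpha> A)"
proof -
  define q where "q = 1 / (4 * r)"
  define Y where "Y = A powr r"
  have Y: "0 < Y" using A by (simp add: Y_def)
  obtain L where L: "0 \<le> L" "\<And>A a b Y Z. 0 < A \<Longrightarrow> a < b \<Longrightarrow> Y = A powr r * (b - a) \<Longrightarrow> 0 < Z \<Longrightarrow>
    covered (Lr_bracket r {a..b} (6 * sqrt (Z * Y))) {a..b} (exp (L * (Y / Z) powr q)) (bounded_root_concave \<alpha> A a b)"
    using bounded_root_concave_covered[OF \<alpha> r] unfolding q_def by blast
  obtain C K where C: "0 \<le> C" and K: "0 \<le> K" and half_line: "\<And>A R Y Z. 0 < A \<Longrightarrow> 0 < R \<Longrightarrow>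
    Y = A powr r * R powr (1 - \<alpha> * r) \<Longrightarrow> 0 < Z \<Longrightarrow>
    covered (Lr_bracket r {R..} (C * sqrt (Z * Y))) {R..} (exp (K * (Y / Z) powr q)) (tail_root_concave \<alpha> A R)"
    using tail_root_concave_covered[OF \<alpha> r \<alpha>r] unfolding q_def by blast
  define D where "D = 6 * sqrt 2 + 2 * C + 1"
  have D: "0 < D" using C by (auto simp: D_def intro: add_nonneg_pos)
  have right: "covered (Lr_bracket r {1..} (C * sqrt (Z * Y))) {1..} (exp (K * (Y / Z) powr q)) (tail_root_concave \<alpha> A 1)"
    if "0 < Z" for Z
    by (rule half_line[OF A _ _ that]) (auto simp: Y_def)
  have line: "covered (Lr_bracket r UNIV (D * sqrt (Z * Y))) UNIV
      (exp ((L * 2 powr q + 2 * K) * (Y / Z) powr q)) (decaying \<alpha> A)" if Z: "0 < Z" for Z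
  proof -
    define X where "X = (Y / Z) powr q"
    have "{x. - x \<in> {1..}} = {..- 1 :: real}" by auto
    moreover have "(\<lambda>x. f (- x)) \<in> tail_root_concave \<alpha> A 1" if "f \<in> decaying \<alpha> A" for f
    proof -
      have f: "\<forall>x. 0 \<le> f x \<and> f x \<le> A \<and> (1 \<le> \<bar>x\<bar> \<longrightarrow> f x \<le> A * \<bar>x\<bar> powr (- \<alpha>))" "root_concave \<alpha> UNIV f"
        using that by (auto simp: decaying_def)
      have "root_concave \<alpha> {1..} (\<lambda>x. f (- x))"
        using root_concave_reflect[OF f(2)] by (auto intro: root_concave_subset)
      moreover have "f (- x) \<le> A * x powr (- \<alpha>)" if "1 \<le> x" for x
        using f(1)[rule_format, of "- x"] that by simp
      ultimately show ?thesis using f(1) by (simp add: tail_root_concave_def)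
    qed
    ultimately have left: "covered (Lr_bracket r {..- 1} (C * sqrt (Z * Y))) {..- 1} (exp (K * X)) (decaying \<alpha> A)"
      using covered_reflect[OF right[OF Z], of "decaying \<alpha> A"] by (simp add: X_def)
    have "covered (Lr_bracket r {- 1..1} (6 * sqrt (Z * (2 * Y)))) {- 1..1} (exp (L * (2 * Y / Z) powr q)) (decaying \<alpha> A)"
      by (rule covered_mono[OF L(2)[OF A _ _ Z]])
        (auto simp: Y_def decaying_def bounded_root_concave_def intro: root_concave_subset)
    moreover have "(2 * Y / Z) powr q = 2 powr q * X"
      unfolding X_def powr_mult[symmetric] by simp
    ultimately have mid: "covered (Lr_bracket r {- 1..1} (6 * sqrt (Z * (2 * Y)))) {- 1..1}
        (exp (L * (2 powr q * X))) (decaying \<alpha> A)" by simp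
    have right': "covered (Lr_bracket r {1..} (C * sqrt (Z * Y))) {1..} (exp (K * X)) (decaying \<alpha> A)"
      unfolding X_def
    proof (rule covered_mono[OF right[OF Z]])
      show "decaying \<alpha> A \<subseteq> tail_root_concave \<alpha> A 1"
      proof
        fix f assume "f \<in> decaying \<alpha> A"
        then have f: "0 \<le> f x \<and> f x \<le> A \<and> (1 \<le> \<bar>x\<bar> \<longrightarrow> f x \<le> A * \<bar>x\<bar> powr (- \<alpha>))"
            "root_concave \<alpha> UNIV f" for x
          by (auto simp: decaying_def)
        have "f x \<le> A * x powr (- \<alpha>)" if "1 \<le> x" for x using f(1)[of x] that by simp
        then show "f \<in> tail_root_concave \<alpha> A 1" using f by (auto simp: tail_root_concave_def intro: root_concave_subset)
      qed
    qed auto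
    have mr: "covered (Lr_bracket r {- 1..} (6 * sqrt (Z * (2 * Y)) + C * sqrt (Z * Y))) {- 1..}
        (exp (L * (2 powr q * X)) * exp (K * X)) (decaying \<alpha> A)"
      by (rule covered_Lr_glue[OF mid right']) (use C Y Z in auto)
    have "covered (Lr_bracket r UNIV (C * sqrt (Z * Y) + (6 * sqrt (Z * (2 * Y)) + C * sqrt (Z * Y)))) UNIV
        (exp (K * X) * (exp (L * (2 powr q * X)) * exp (K * X))) (decaying \<alpha> A)"
    proof (rule covered_glue[OF left mr, where m = "- 1"])
      fix b c :: "(real \<Rightarrow> real) \<times> (real \<Rightarrow> real)"
      assume "Lr_bracket r {..- 1} (C * sqrt (Z * Y)) b" "Lr_bracket r {- 1..} (6 * sqrt (Z * (2 * Y)) + C * sqrt (Z * Y)) c"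
      then show "Lr_bracket r UNIV (C * sqrt (Z * Y) + (6 * sqrt (Z * (2 * Y)) + C * sqrt (Z * Y))) (glue (- 1) b c)"
        by (rule Lr_bracket_glue) (use C Y Z in auto)
    qed auto
    then show ?thesis
    proof (rule covered_mono)
      show "exp (K * X) * (exp (L * (2 powr q * X)) * exp (K * X)) \<le> exp ((L * 2 powr q + 2 * K) * (Y / Z) powr q)"
        by (simp add: X_def[symmetric] exp_add[symmetric] algebra_simps)
      have "C * sqrt (Z * Y) + (6 * sqrt (Z * (2 * Y)) + C * sqrt (Z * Y)) \<le> D * sqrt (Z * Y)"
        unfolding D_def real_sqrt_mult using Y Z by (simp add: algebra_simps)
      then show "Lr_bracket r UNIV (D * sqrt (Z * Y)) b"
        if "Lr_bracket r UNIV (C * sqrt (Z * Y) + (6 * sqrt (Z * (2 * Y)) + C * sqrt (Z * Y))) b" for b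
        using that Lr_bracket_mono by blast
    qed auto
  qed
  show ?thesis
  proof (rule that[of "(L * 2 powr q + 2 * K) * (D * Y) powr (2 * q)"])
    fix \<epsilon> :: real assume \<epsilon>: "0 < \<epsilon>"
    \<comment> \<open>Chosen so that \<open>D * sqrt (Z * Y)\<close> equals
      \<open>\<epsilon> powr r\<close>. Then \<open>Y / Z = (1 / t)^2\<close>, and its power
      \<open>1 / (4 * r)\<close> is a constant multiple of
      \<open>\<epsilon> powr (- 1 / 2)\<close>.\<close>
    define t where "t = \<epsilon> powr r / (D * Y)"
    define Z where "Z = t\<^sup>2 * Y"
    have t: "0 < t" using \<epsilon> D Y by (simp add: t_def)
    have Z: "0 < Z" using t Y by (simp add: Z_def)
    have "sqrt (Z * Y) = t * Y"
      using t Y by (intro real_sqrt_unique) (auto simp: Z_def power2_eq_square)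
    then have E: "D * sqrt (Z * Y) = \<epsilon> powr r" using D Y by (simp add: t_def)
    have "Y / Z = (1 / t)\<^sup>2" using Y by (simp add: Z_def power_divide)
    also have "\<dots> = (1 / t) powr 2" using t by (simp add: powr_numeral)
    finally have "(Y / Z) powr q = (1 / t) powr (2 * q)" by (simp add: powr_powr)
    also have "1 / t = D * Y * \<epsilon> powr (- r)" by (simp add: t_def powr_minus_divide)
    also have "\<dots> powr (2 * q) = (D * Y) powr (2 * q) * \<epsilon> powr (- r * (2 * q))"
      by (simp only: powr_mult powr_powr)
    also have "- r * (2 * q) = - 1 / 2" using r by (simp add: q_def)
    finally have "(Y / Z) powr q = (D * Y) powr (2 * q) * \<epsilon> powr (- 1 / 2)" .
    then show "covered (Lr_bracket r UNIV (\<epsilon> powr r)) UNIV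
        (exp ((L * 2 powr q + 2 * K) * (D * Y) powr (2 * q) * \<epsilon> powr (- 1 / 2))) (decaying \<alpha> A)"
      using line[OF Z] unfolding E by (simp add: mult.assoc)
  qed
qed

section \<open>Square roots of s-concave densities\<close>

lemma convex_on_powr_neg:
  assumes "0 < c"
  shows "convex_on {0<..} (\<lambda>v::real. v powr (- c))"
proof (rule convex_on_realI[where f' = "\<lambda>v. - c * v powr (- c - 1)"])
  fix x :: real assume "x \<in> {0<..}"
  then show "((\<lambda>v. v powr (- c)) has_real_derivative - c * x powr (- c - 1)) (at x)"
    by (intro has_real_derivative_powr) auto
next
  fix x y :: real assume "x \<in> {0<..}" "y \<in> {0<..}" "x \<le> y"
  then have "y powr (- c - 1) \<le> x powr (- c - 1)" using assms by (intro powr_mono2') auto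
  then show "- c * x powr (- c - 1) \<le> - c * y powr (- c - 1)" using assms by simp
qed auto

text \<open>The auxiliary \<open>\<theta>\<close> sends a value \<open>v\<close> of
  \<open>\<phi>\<close> to the corresponding value of \<open>sqrt p powr (- 1 / \<alpha>)\<close>.
  On \<open>P\<close>, where \<open>h s\<close> is finite and positive, it is convex and decreasing,
  so its composition with the concave \<open>\<phi>\<close> is convex. For \<open>s < 0\<close> the
  prescribed \<open>\<alpha>\<close> makes \<open>\<theta>\<close> the map
  \<open>v \<mapsto> - v\<close>; for \<open>s \<ge> 0\<close> every positive
  \<open>\<alpha>\<close> works.\<close>

lemma root_concave_sqrt_h:
  assumes \<phi>: "proper_concave \<phi>" and p: "\<And>x. ennreal (p x) = h s (\<phi> x)" "\<And>x. 0 \<le> p x"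
    and \<alpha>: "0 < \<alpha>" "s < 0 \<Longrightarrow> \<alpha> = - 1 / (2 * s)"
  shows "root_concave \<alpha> UNIV (\<lambda>x. sqrt (p x))"
proof -
  define \<theta> :: "real \<Rightarrow> real" where "\<theta> = (\<lambda>v. if s = 0 then exp (- v / (2 * \<alpha>)) else if s < 0 then - v
    else v powr (- (1 / (2 * s * \<alpha>))))"
  define P where "P = {v. (s < 0 \<longrightarrow> v < 0) \<and> (0 < s \<longrightarrow> (0::real) < v)}"
  have fin: "\<phi> x < \<infinity>" for x using \<phi> by (simp add: proper_concave_def)
  have val: "0 < sqrt (p x) \<and> sqrt (p x) powr (- 1 / \<alpha>) = \<theta> v \<and> v \<in> P"
    if "\<phi> x = ereal v" "0 < s \<Longrightarrow> 0 < v" for x v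
  proof -
    consider "s = 0" | "s < 0" | "0 < s" by linarith
    then show ?thesis
    proof cases
      case 1
      then have "ennreal (p x) = ennreal (exp v)" using p(1)[of x] that by (simp add: h_def)
      then have "p x = exp v" using p(2) by (simp add: ennreal_inj)
      then have "sqrt (p x) = exp (v / 2)" by (intro real_sqrt_unique) (auto simp: power2_eq_square exp_add[symmetric])
      then show ?thesis using 1 by (simp add: \<theta>_def P_def exp_powr_real)
    next
      case 2
      \<comment> \<open>Here \<open>h s\<close> would be infinite at nonnegative \<open>v\<close>,
        whereas \<open>p\<close> is real-valued.\<close>
      have "v < 0"
      proof (rule ccontr)
        assume "\<not> v < 0"
        then have "ennreal (p x) = \<infinity>" using p(1)[of x] that 2 by (simp add: h_def)
        then show False by simp
      qed
      then have "ennreal (p x) = ennreal ((- v) powr (1 / s))" using p(1)[of x] that 2 by (simp add: h_def)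
      then have px: "p x = (- v) powr (1 / s)" using p(2) by (simp add: ennreal_inj)
      then have "sqrt (p x) = (- v) powr (1 / s * (1 / 2))"
        unfolding powr_powr[symmetric] using p(2)[of x] by (simp add: powr_half_sqrt)
      moreover have "1 / s * (1 / 2) = - \<alpha>" using \<alpha>(2) 2 by simp
      ultimately have "sqrt (p x) = (- v) powr (- \<alpha>)" by simp
      then show ?thesis using 2 \<open>v < 0\<close> \<alpha>(1) by (simp add: \<theta>_def P_def powr_powr)
    next
      case 3
      then have v: "0 < v" using that by simp
      then have "ennreal (p x) = ennreal (v powr (1 / s))" using p(1)[of x] that 3 by (simp add: h_def)
      then have px: "p x = v powr (1 / s)" using p(2) by (simp add: ennreal_inj)
      then have "sqrt (p x) = v powr (1 / s * (1 / 2))"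
        unfolding powr_powr[symmetric] using p(2)[of x] by (simp add: powr_half_sqrt)
      then show ?thesis using 3 v by (simp add: \<theta>_def P_def powr_powr mult_ac)
    qed
  qed
  have pos: "\<exists>v. \<phi> x = ereal v \<and> (0 < s \<longrightarrow> 0 < v)" if "0 < sqrt (p x)" for x
  proof (cases "\<phi> x")
    case (real v)
    have "0 < v" if "0 < s"
    proof (rule ccontr)
      assume "\<not> 0 < v"
      then have "ennreal (p x) = 0" using p(1)[of x] real \<open>0 < s\<close> by (simp add: h_def max_def)
      then show False using \<open>0 < sqrt (p x)\<close> p(2)[of x] by simp
    qed
    then show ?thesis using real by blast
  next
    case PInf
    then show ?thesis using fin[of x] by simp
  next
    case MInf
    then have "ennreal (p x) = 0" using p(1)[of x] by (simp add: h_def)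
    then show ?thesis using that p(2)[of x] by simp
  qed
  have anti: "\<theta> w \<le> \<theta> v" if "v \<in> P" "v \<le> w" for v w
  proof -
    consider "s = 0" | "s < 0" | "0 < s" by linarith
    then show ?thesis
    proof cases
      case 1
      then show ?thesis using that \<alpha>(1) by (simp add: \<theta>_def divide_right_mono)
    next
      case 2
      then show ?thesis using that by (simp add: \<theta>_def)
    next
      case 3
      then show ?thesis using that \<alpha>(1) by (auto simp: \<theta>_def P_def intro!: powr_mono2')
    qed
  qed
  have cvx: "\<theta> ((1 - t) * v + t * w) \<le> (1 - t) * \<theta> v + t * \<theta> w"
    if "v \<in> P" "w \<in> P" "0 \<le> t" "t \<le> 1" for v w t
  proof -
    consider "s = 0" | "s < 0" | "0 < s" by linarith
    then show ?thesis
    proof cases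
      case 1
      have eq: "- ((1 - t) * v + t * w) / (2 * \<alpha>) = (1 - t) * (- v / (2 * \<alpha>)) + t * (- w / (2 * \<alpha>))"
      proof -
        have "- ((1 - t) * v + t * w) = (1 - t) * (- v) + t * (- w)" by (simp add: algebra_simps)
        then show ?thesis by (simp only: add_divide_distrib times_divide_eq_right)
      qed
      have "exp (- ((1 - t) * v + t * w) / (2 * \<alpha>))
          \<le> (1 - t) * exp (- v / (2 * \<alpha>)) + t * exp (- w / (2 * \<alpha>))"
        unfolding eq
        using convex_onD[OF exp_convex that(3,4), of "- v / (2 * \<alpha>)" "- w / (2 * \<alpha>)"]
        unfolding real_scaleR_def by blast
      then show ?thesis unfolding \<theta>_def if_P[OF 1] .
    next
      case 2
      then show ?thesis by (simp add: \<theta>_def algebra_simps)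
    next
      case 3
      then have "0 < 1 / (2 * s * \<alpha>)" using \<alpha>(1) by simp
      from convex_onD[OF convex_on_powr_neg[OF this] that(3,4), of v w] show ?thesis
        using 3 that(1,2) by (simp add: \<theta>_def P_def)
    qed
  qed
  show ?thesis
    unfolding root_concave_def
  proof (intro ballI allI impI)
    fix x y t :: real
    assume "0 \<le> t \<and> t \<le> 1 \<and> 0 < sqrt (p x) \<and> 0 < sqrt (p y)"
    then have t: "0 \<le> t" "t \<le> 1" and xy: "0 < sqrt (p x)" "0 < sqrt (p y)" by auto
    define z where "z = (1 - t) * x + t * y"
    obtain v where v: "\<phi> x = ereal v" "0 < s \<longrightarrow> 0 < v" using pos[OF xy(1)] by blast
    obtain w where w: "\<phi> y = ereal w" "0 < s \<longrightarrow> 0 < w" using pos[OF xy(2)] by blast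
    have "ereal (1 - t) * \<phi> x + ereal t * \<phi> y \<le> \<phi> z"
    proof (cases "0 < t \<and> t < 1")
      case True
      then show ?thesis using \<phi> unfolding proper_concave_def z_def by blast
    next
      \<comment> \<open>\<open>proper_concave\<close> speaks only of \<open>0 < t < 1\<close>, which
        avoids products of 0 with an infinite value; the end points are checked separately.\<close>
      case False
      then have "t = 0 \<or> t = 1" using t by auto
      then show ?thesis by (auto simp: z_def v w one_ereal_def[symmetric] zero_ereal_def[symmetric])
    qed
    then have le: "ereal ((1 - t) * v + t * w) \<le> \<phi> z" by (simp add: v w)
    then obtain c where c: "\<phi> z = ereal c" using fin[of z] by (cases "\<phi> z") auto
    have vc: "(1 - t) * v + t * w \<le> c" using le c by simp
    have pc: "0 < (1 - t) * v + t * w" if "0 < s"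
      using v(2) w(2) that t by (cases "t = 0") (auto intro: add_nonneg_pos)
    have Z: "0 < sqrt (p z)" "sqrt (p z) powr (- 1 / \<alpha>) = \<theta> c"
      using val[OF c] pc vc by fastforce+
    have V: "sqrt (p x) powr (- 1 / \<alpha>) = \<theta> v" "v \<in> P" using val[OF v(1)] v(2) by auto
    have W: "sqrt (p y) powr (- 1 / \<alpha>) = \<theta> w" "w \<in> P" using val[OF w(1)] w(2) by auto
    have "convex P" unfolding P_def
    proof (cases "s = 0")
      case False
      have "{v. (s < 0 \<longrightarrow> v < 0) \<and> (0 < s \<longrightarrow> (0::real) < v)} = (if s < 0 then {..<0} else {0<..})"
        using False by auto
      then show "convex {v. (s < 0 \<longrightarrow> v < 0) \<and> (0 < s \<longrightarrow> (0::real) < v)}" by simp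
    qed simp
    then have "(1 - t) * v + t * w \<in> P"
      using convexD_alt[of P v w t] V(2) W(2) t by simp
    from anti[OF this vc] cvx[OF V(2) W(2) t]
    show "0 < sqrt (p ((1 - t) * x + t * y)) \<and> sqrt (p ((1 - t) * x + t * y)) powr (- 1 / \<alpha>)
        \<le> (1 - t) * sqrt (p x) powr (- 1 / \<alpha>) + t * sqrt (p y) powr (- 1 / \<alpha>)"
      unfolding z_def[symmetric] V(1) W(1) Z(2) using Z(1) by simp
  qed
qed

text \<open>With \<open>g = f powr (- 1 / \<alpha>)\<close>, convexity and
  \<open>g 0 \<le> B\<close> keep \<open>g\<close> below \<open>2 * B\<close> on the segment from 0
  to \<open>l * x\<close>. There \<open>f\<close> is at least \<open>\<kappa>\<close>, so the bound
  on the integral of \<open>f^2\<close> limits the length: \<open>l * \<bar>x\<bar> \<le> T\<close>.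
  Either \<open>\<bar>x\<bar> \<le> T\<close>, or \<open>g x\<close> is at least proportional to
  \<open>\<bar>x\<bar>\<close>.\<close>

lemma envelope:
  fixes \<alpha> S :: real
  assumes \<alpha>: "0 < \<alpha>" and S: "0 < S"
  obtains A where "0 < A" "\<And>f. (\<And>x. 0 \<le> f x \<and> f x \<le> S) \<Longrightarrow> (\<And>x. \<bar>x\<bar> \<le> 1 \<Longrightarrow> 1 / S \<le> f x) \<Longrightarrow>
    root_concave \<alpha> UNIV f \<Longrightarrow> (\<integral>\<^sup>+x. ennreal ((f x)\<^sup>2) \<partial>lborel) \<le> 1 \<Longrightarrow> f \<in> decaying \<alpha> A"
proof -
  define B where "B = (1 / S) powr (- 1 / \<alpha>)"
  define T where "T = (2 * B) powr (2 * \<alpha>)"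
  \<comment> \<open>One summand each for the uniform bound, for points with
    \<open>\<bar>x\<bar> \<le> T\<close>, and for points where
    \<open>g x \<ge> B / T * \<bar>x\<bar>\<close>.\<close>
  define A where "A = S + S * T powr \<alpha> + (B / T) powr (- \<alpha>)"
  have B: "0 < B" and T: "0 < T" using S by (simp_all add: B_def T_def)
  have A: "S \<le> A" "S * T powr \<alpha> \<le> A" "(B / T) powr (- \<alpha>) \<le> A" using S by (simp_all add: A_def)
  show ?thesis
  proof (rule that[of A])
    show "0 < A" using S A(1) by simp
    fix f assume f: "\<And>x. 0 \<le> f x \<and> f x \<le> S" "\<And>x. \<bar>x\<bar> \<le> 1 \<Longrightarrow> 1 / S \<le> f x"
      and rc: "root_concave \<alpha> UNIV f" and int: "(\<integral>\<^sup>+x. ennreal ((f x)\<^sup>2) \<partial>lborel) \<le> 1"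
    have f0: "1 / S \<le> f 0" "0 < f 0" using f(2)[of 0] S by (auto intro: less_le_trans[of 0 "1 / S"])
    have g0: "f 0 powr (- 1 / \<alpha>) \<le> B"
      unfolding B_def using f0 S \<alpha> by (intro powr_mono2') auto
    have "f x \<le> A * \<bar>x\<bar> powr (- \<alpha>)" if x: "1 \<le> \<bar>x\<bar>" for x
    proof (cases "f x = 0")
      case True
      then show ?thesis using \<open>0 < A\<close> by simp
    next
      case False
      then have fx: "0 < f x" using f(1)[of x] by simp
      define g where "g = f x powr (- 1 / \<alpha>)"
      have g: "0 < g" using fx by (simp add: g_def)
      have fg: "f x = g powr (- \<alpha>)" using fx \<alpha> by (simp add: g_def powr_powr)
      \<comment> \<open>The largest fraction of the way to \<open>x\<close> for which the
        contribution \<open>l * g\<close> of the far end stays below \<open>B\<close>.\<close>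
      define l where "l = min 1 (B / g)"
      have l: "0 < l" "l \<le> 1" "l * g \<le> B" using B g by (auto simp: l_def min_def field_simps)
      define \<kappa> where "\<kappa> = (2 * B) powr (- \<alpha>)"
      have "\<kappa> \<le> f (u * x)" if u: "0 \<le> u" "u \<le> l" for u
      proof -
        have u1: "u \<le> 1" using u l by simp
        have F: "0 < f (u * x)" "f (u * x) powr (- 1 / \<alpha>) \<le> (1 - u) * f 0 powr (- 1 / \<alpha>) + u * g"
          using root_concaveD[OF rc, of 0 x u] u u1 f0 fx by (auto simp: g_def)
        have "(1 - u) * f 0 powr (- 1 / \<alpha>) + u * g \<le> 1 * B + l * g"
          using u u1 g0 g B by (intro add_mono mult_mono) auto
        then have "f (u * x) powr (- 1 / \<alpha>) \<le> 2 * B" using F(2) l(3) by simp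
        then have "\<kappa> \<le> (f (u * x) powr (- 1 / \<alpha>)) powr (- \<alpha>)"
          unfolding \<kappa>_def using F(1) \<alpha> by (intro powr_mono2') auto
        then show ?thesis using F(1) \<alpha> by (simp add: powr_powr)
      qed
      note \<kappa>f = this
      define a where "a = min 0 (l * x)"
      define b where "b = max 0 (l * x)"
      have ab: "a \<le> b" "b - a = l * \<bar>x\<bar>" 
        using l(1) x mult_pos_pos[of l x] mult_pos_neg[of l x] by (auto simp: a_def b_def min_def max_def abs_if)
      have seg: "\<kappa> \<le> f y" if y: "y \<in> {a..b}" for y
      proof -
        have "0 \<le> y / x" "y / x \<le> l"
          using y x l(1) by (auto simp: a_def b_def min_def max_def field_simps zero_le_divide_iff mult_le_0_iff zero_le_mult_iff split: if_splits)
        from \<kappa>f[OF this] show ?thesis using x by auto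
      qed
      have \<kappa>0: "0 \<le> \<kappa>" by (simp add: \<kappa>_def)
      have "ennreal (\<kappa>\<^sup>2 * (b - a)) = (\<integral>\<^sup>+y. ennreal (\<kappa>\<^sup>2) * indicator {a..b} y \<partial>lborel)"
        using ab(1) by (simp add: nn_integral_cmult_indicator ennreal_mult)
      also have "\<dots> \<le> (\<integral>\<^sup>+y. ennreal ((f y)\<^sup>2) \<partial>lborel)"
        using seg \<kappa>0 by (intro nn_integral_mono) (auto simp: indicator_def intro!: ennreal_leI power_mono)
      also note int
      finally have "\<kappa>\<^sup>2 * (l * \<bar>x\<bar>) \<le> 1" unfolding ab(2) by (simp only: ennreal_le_1)
      moreover have "\<kappa>\<^sup>2 = 1 / T"
      proof -
        have "\<kappa>\<^sup>2 = \<kappa> powr 2" using B by (simp add: \<kappa>_def powr_numeral)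
        also have "\<dots> = (2 * B) powr (- (2 * \<alpha>))" by (simp add: \<kappa>_def powr_powr mult.commute)
        finally show ?thesis by (simp add: T_def powr_minus_divide)
      qed
      ultimately have lx: "l * \<bar>x\<bar> \<le> T" using T by (simp add: field_simps)
      have x0: "0 < \<bar>x\<bar>" using x by linarith
      show ?thesis
      proof (cases "g \<le> B")
        case True
        then have "\<bar>x\<bar> \<le> T" using lx g by (simp add: l_def min_def field_simps split: if_splits)
        then have "\<bar>x\<bar> powr \<alpha> \<le> T powr \<alpha>" using \<alpha> by (intro powr_mono2) auto
        then have "S \<le> S * T powr \<alpha> * \<bar>x\<bar> powr (- \<alpha>)"
          using S x0 by (simp add: powr_minus_divide field_simps)
        also have "\<dots> \<le> A * \<bar>x\<bar> powr (- \<alpha>)" using A(2) by (intro mult_right_mono) auto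
        finally show ?thesis using f(1)[of x] by simp
      next
        case False
        then have "B / g * \<bar>x\<bar> \<le> T" using lx g by (simp add: l_def min_def field_simps split: if_splits)
        then have "B / T * \<bar>x\<bar> \<le> g" using g T by (simp add: field_simps)
        then have "g powr (- \<alpha>) \<le> (B / T * \<bar>x\<bar>) powr (- \<alpha>)"
          using B T x0 \<alpha> by (intro powr_mono2') auto
        also have "\<dots> = (B / T) powr (- \<alpha>) * \<bar>x\<bar> powr (- \<alpha>)" by (rule powr_mult)
        also have "\<dots> \<le> A * \<bar>x\<bar> powr (- \<alpha>)" using A(3) by (intro mult_right_mono) auto
        finally show ?thesis unfolding fg .
      qed
    qed
    moreover have "0 \<le> f x \<and> f x \<le> A" for x using f(1)[of x] A(1) by simp
    ultimately show "f \<in> decaying \<alpha> A" using rc by (simp add: decaying_def)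
  qed
qed

lemma sqrt_density_decaying:
  assumes M: "0 < M" and \<alpha>: "0 < \<alpha>" "s < 0 \<Longrightarrow> \<alpha> = - 1 / (2 * s)"
  obtains A where "0 < A" "\<And>p. p \<in> bounded_s_concave_densities M s \<Longrightarrow> (\<lambda>x. sqrt (p x)) \<in> decaying \<alpha> A"
proof -
  have "0 < sqrt M" using M by simp
  then obtain A where A: "0 < A" "\<And>f. (\<And>x. 0 \<le> f x \<and> f x \<le> sqrt M) \<Longrightarrow>
    (\<And>x. \<bar>x\<bar> \<le> 1 \<Longrightarrow> 1 / sqrt M \<le> f x) \<Longrightarrow>
    root_concave \<alpha> UNIV f \<Longrightarrow> (\<integral>\<^sup>+x. ennreal ((f x)\<^sup>2) \<partial>lborel) \<le> 1 \<Longrightarrow> f \<in> decaying \<alpha> A"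
    using envelope[OF \<alpha>(1), of "sqrt M"] by blast
  show ?thesis
  proof (rule that[OF A(1)])
    fix p assume "p \<in> bounded_s_concave_densities M s"
    then have p: "\<And>x. 0 \<le> p x" "(\<lambda>x. ennreal (p x)) \<in> s_concave_densities s"
      "(SUP x. ennreal (p x)) \<le> ennreal M" "\<And>x. \<bar>x\<bar> \<le> 1 \<Longrightarrow> 1 / M \<le> p x"
      by (auto simp: bounded_s_concave_densities_def)
    obtain \<phi> where \<phi>: "\<phi> \<in> closed_proper_concave" "(\<lambda>x. ennreal (p x)) = (\<lambda>x. h s (\<phi> x))"
      "(\<integral>\<^sup>+x. ennreal (p x) \<partial>lborel) = 1"
      using p(2) by (auto simp: s_concave_densities_def)
    show "(\<lambda>x. sqrt (p x)) \<in> decaying \<alpha> A"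
    proof (rule A(2))
      fix x
      have "ennreal (p x) \<le> ennreal M" using p(3) by (meson SUP_upper UNIV_I order_trans)
      then have "p x \<le> M" using M by (simp add: ennreal_le_iff)
      then show "0 \<le> sqrt (p x) \<and> sqrt (p x) \<le> sqrt M" using p(1) by simp
    next
      fix x :: real assume "\<bar>x\<bar> \<le> 1"
      from real_sqrt_le_mono[OF p(4)[OF this]] show "1 / sqrt M \<le> sqrt (p x)"
        by (simp add: real_sqrt_divide)
    next
      show "root_concave \<alpha> UNIV (\<lambda>x. sqrt (p x))"
        using \<phi>(1) fun_cong[OF \<phi>(2)] p(1) \<alpha>
        by (intro root_concave_sqrt_h[of \<phi> p s]) (auto simp: closed_proper_concave_def)
    next
      show "(\<integral>\<^sup>+x. ennreal ((sqrt (p x))\<^sup>2) \<partial>lborel) \<le> 1" using \<phi>(3) p(1) by simp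
    qed
  qed
qed

section \<open>From finite families to bracketing numbers\<close>

lemma log_enat_le:
  assumes "n \<le> enat k" "real k \<le> exp c"
  shows "log_enat n \<le> ereal c"
proof -
  obtain m where m: "n = enat m" "m \<le> k" using assms(1) by (cases n) auto
  have "ln (real m) \<le> c" if "m \<noteq> 0"
  proof -
    have "real m \<le> exp c" using m(2) assms(2) by (meson of_nat_mono order_trans)
    then have "ln (real m) \<le> ln (exp c)" using that by (intro ln_mono) auto
    then show ?thesis by simp
  qed
  then show ?thesis by (auto simp: log_enat_def m)
qed

lemma bracketing_number_le:
  assumes "covered Q UNIV (exp c) F"
    "\<And>l u. Q (l, u) \<Longrightarrow> l \<in> G \<and> u \<in> G \<and> (\<forall>x. l x \<le> u x) \<and> d l u \<le> ennreal \<epsilon>"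
  shows "log_enat (bracketing_number G \<epsilon> F d) \<le> ereal c"
proof -
  obtain B where B: "finite B" "real (card B) \<le> exp c" "\<forall>b\<in>B. Q b" "\<forall>f\<in>F. \<exists>b\<in>B. encloses UNIV b f"
    using assms(1) unfolding covered_def by blast
  have "F \<subseteq> (\<Union>(l, u) \<in> B. bracket l u)"
    using B(4) by (fastforce simp: encloses_def bracket_def)
  moreover have "\<forall>(l, u) \<in> B. l \<in> G \<and> u \<in> G \<and> (\<forall>x. l x \<le> u x) \<and> d l u \<le> ennreal \<epsilon>"
    using B(3) assms(2) by blast
  ultimately have "bracketing_number G \<epsilon> F d \<le> enat (card B)"
    unfolding bracketing_number_def using B(1) by (intro Inf_lower) blast
  then show ?thesis using B(2) by (rule log_enat_le)
qed

lemma ennreal_powr_le: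
  assumes "I \<le> ennreal (\<epsilon> powr r)" "0 < \<epsilon>" "0 < r"
  shows "ennreal_powr I (1 / r) \<le> ennreal \<epsilon>"
proof -
  have I: "I \<noteq> \<infinity>" using assms(1) by (auto simp: top_unique)
  have "enn2real I \<le> \<epsilon> powr r" using enn2real_mono[OF assms(1)] by simp
  then have "enn2real I powr (1 / r) \<le> (\<epsilon> powr r) powr (1 / r)"
    using assms by (intro powr_mono2) auto
  also have "\<dots> = \<epsilon>" using assms by (simp add: powr_powr)
  finally show ?thesis using I by (simp add: ennreal_powr_def ennreal_leI)
qed

lemma sqrt_densities_covered:
  fixes M s r :: real
  assumes M: "0 < M" and r: "1 \<le> r" and s: "0 \<le> s \<or> s < 0 \<and> - 1 / s > 2 / r"
  obtains K where "\<And>\<epsilon>. 0 < \<epsilon> \<Longrightarrow>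
    covered (Lr_bracket r UNIV (\<epsilon> powr r)) UNIV (exp (K * \<epsilon> powr (- 1 / 2))) (sqrt_bounded_s_concave_densities M s)"
proof -
  \<comment> \<open>For \<open>s < 0\<close> this is half of \<open>- 1 / s\<close>, so
    \<open>1 < \<alpha> * r\<close> is precisely the assumption \<open>- 1 / s > 2 / r\<close>; for
    \<open>s \<ge> 0\<close> the value 2 satisfies it for all \<open>r \<ge> 1\<close>.\<close>
  define \<alpha> where "\<alpha> = (if 0 \<le> s then 2 else - 1 / (2 * s))"
  have \<alpha>: "0 < \<alpha>" "s < 0 \<Longrightarrow> \<alpha> = - 1 / (2 * s)" by (auto simp: \<alpha>_def divide_less_0_iff)
  have \<alpha>r: "1 < \<alpha> * r" using s r by (auto simp: \<alpha>_def field_simps)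
  obtain A where A: "0 < A" "\<And>p. p \<in> bounded_s_concave_densities M s \<Longrightarrow> (\<lambda>x. sqrt (p x)) \<in> decaying \<alpha> A"
    using sqrt_density_decaying[OF M \<alpha>] by blast
  obtain K where K: "\<And>\<epsilon>. 0 < \<epsilon> \<Longrightarrow>
    covered (Lr_bracket r UNIV (\<epsilon> powr r)) UNIV (exp (K * \<epsilon> powr (- 1 / 2))) (decaying \<alpha> A)"
    using decaying_covered[OF \<alpha>(1) r \<alpha>r A(1)] by blast
  have "sqrt_bounded_s_concave_densities M s \<subseteq> decaying \<alpha> A"
    using A(2) by (auto simp: sqrt_bounded_s_concave_densities_def)
  then show ?thesis using that[of K] covered_mono[OF K] by blast
qed

theorem theorem3p1:
  fixes M s :: real
  assumes "0 < M"
  shows "(\<forall>r::real. 1 \<le> r \<and> (0 \<le> s \<or> (s < 0 \<and> - 1 / s > 2 / r)) \<longrightarrow>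
            (\<exists>K::real. \<forall>\<epsilon>>0.
               log_enat (L_bracketing_number r \<epsilon> (sqrt_bounded_s_concave_densities M s))
                 \<le> ereal (K * \<epsilon> powr (- 1 / 2)))) \<and>
         (- 1 < s \<longrightarrow>
            (\<exists>K'::real. \<forall>\<epsilon>>0.
               log_enat (hellinger_bracketing_number \<epsilon> (bounded_s_concave_densities M s))
                 \<le> ereal (K' * \<epsilon> powr (- 1 / 2))))"
proof (intro conjI allI impI)
  fix r :: real assume "1 \<le> r \<and> (0 \<le> s \<or> (s < 0 \<and> - 1 / s > 2 / r))"
  then have r: "1 \<le> r" and s: "0 \<le> s \<or> s < 0 \<and> - 1 / s > 2 / r" by auto
  obtain K where K: "\<And>\<epsilon>. 0 < \<epsilon> \<Longrightarrow>
    covered (Lr_bracket r UNIV (\<epsilon> powr r)) UNIV (exp (K * \<epsilon> powr (- 1 / 2))) (sqrt_bounded_s_concave_densities M s)"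
    using sqrt_densities_covered[OF assms r s] by blast
  show "\<exists>K::real. \<forall>\<epsilon>>0. log_enat (L_bracketing_number r \<epsilon> (sqrt_bounded_s_concave_densities M s))
      \<le> ereal (K * \<epsilon> powr (- 1 / 2))"
  proof (intro exI allI impI)
    fix \<epsilon> :: real assume \<epsilon>: "0 < \<epsilon>"
    show "log_enat (L_bracketing_number r \<epsilon> (sqrt_bounded_s_concave_densities M s)) \<le> ereal (K * \<epsilon> powr (- 1 / 2))"
      unfolding L_bracketing_number_def
    proof (rule bracketing_number_le[OF K[OF \<epsilon>]])
      fix l u :: "real \<Rightarrow> real" assume lu: "Lr_bracket r UNIV (\<epsilon> powr r) (l, u)"
      have "\<bar>l x - u x\<bar> = u x - l x" for x using lu by (simp add: Lr_bracket_def)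
      then have "L_dist r l u \<le> ennreal \<epsilon>"
        unfolding L_dist_def using lu \<epsilon> r by (intro ennreal_powr_le) (auto simp: Lr_bracket_def)
      then show "l \<in> borel_measurable lborel \<and> u \<in> borel_measurable lborel \<and>
          (\<forall>x. l x \<le> u x) \<and> L_dist r l u \<le> ennreal \<epsilon>"
        using lu by (simp add: Lr_bracket_def)
    qed
  qed
next
  assume s: "- 1 < s"
  have "0 \<le> s \<or> s < 0 \<and> - 1 / s > 2 / 2" using s by (auto simp: field_simps)
  then obtain K where K: "\<And>\<epsilon>. 0 < \<epsilon> \<Longrightarrow>
    covered (Lr_bracket 2 UNIV (\<epsilon> powr 2)) UNIV (exp (K * \<epsilon> powr (- 1 / 2))) (sqrt_bounded_s_concave_densities M s)"
    using sqrt_densities_covered[OF assms, of 2 s] by auto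
  show "\<exists>K'::real. \<forall>\<epsilon>>0. log_enat (hellinger_bracketing_number \<epsilon> (bounded_s_concave_densities M s))
      \<le> ereal (K' * \<epsilon> powr (- 1 / 2))"
  proof (intro exI allI impI)
    fix \<epsilon> :: real assume \<epsilon>: "0 < \<epsilon>"
    define G where "G = {f \<in> borel_measurable lborel. \<forall>x::real. (0::real) \<le> f x}"
    define Q where "Q = (\<lambda>(l, u). l \<in> G \<and> u \<in> G \<and> (\<forall>x. l x \<le> u x) \<and> hellinger_dist l u \<le> ennreal \<epsilon>)"
    have "covered Q UNIV (exp (K * \<epsilon> powr (- 1 / 2))) (bounded_s_concave_densities M s)"
    \<comment> \<open>Brackets for the square roots are squared. Their ends are nonnegative, so
      squaring preserves the order, and the Hellinger distance of the squares is the
      \<open>L_2\<close> distance of the original ends up to the factor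
      \<open>sqrt (1 / 2)\<close>.\<close>
    proof (rule covered_map[OF K[OF \<epsilon>], where T = "\<lambda>b. (\<lambda>x. (fst b x)\<^sup>2, \<lambda>x. (snd b x)\<^sup>2)"])
      fix b :: "(real \<Rightarrow> real) \<times> (real \<Rightarrow> real)" assume b: "Lr_bracket 2 UNIV (\<epsilon> powr 2) b"
      then have b': "fst b \<in> borel_measurable borel" "snd b \<in> borel_measurable borel"
        "\<And>x. 0 \<le> fst b x" "\<And>x. fst b x \<le> snd b x" by (auto simp: Lr_bracket_def)
      have b0: "0 \<le> snd b x" for x using b'(3,4)[of x] by linarith
      have sq: "(sqrt ((fst b x)\<^sup>2) - sqrt ((snd b x)\<^sup>2))\<^sup>2 = (snd b x - fst b x) powr 2" for x
        using b'(3,4)[of x] b0[of x] by (simp add: powr_numeral power2_commute)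
      \<comment> \<open>The factor one half in the Hellinger distance is simply bounded by
        one.\<close>
      have "1 / 2 * (\<integral>\<^sup>+x. ennreal ((snd b x - fst b x) powr 2) \<partial>lborel)
          \<le> 1 * (\<integral>\<^sup>+x. ennreal ((snd b x - fst b x) powr 2) \<partial>lborel)"
        by (intro mult_right_mono) (auto simp: divide_le_posI_ennreal)
      also have "\<dots> \<le> ennreal (\<epsilon> powr 2)" using b by (simp add: Lr_bracket_def del: powr_numeral)
      finally have "hellinger_dist (\<lambda>x. (fst b x)\<^sup>2) (\<lambda>x. (snd b x)\<^sup>2) \<le> ennreal \<epsilon>"
        unfolding hellinger_dist_def sq by (rule ennreal_powr_le) (use \<epsilon> in auto)
      then show "Q (\<lambda>x. (fst b x)\<^sup>2, \<lambda>x. (snd b x)\<^sup>2)"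
        using b' unfolding Q_def G_def by (auto intro: power_mono)
    next
      fix p assume p: "p \<in> bounded_s_concave_densities M s"
      have p0: "0 \<le> p x" for x using p by (simp add: bounded_s_concave_densities_def)
      have "encloses UNIV (\<lambda>x. (fst b x)\<^sup>2, \<lambda>x. (snd b x)\<^sup>2) p"
        if b: "Lr_bracket 2 UNIV (\<epsilon> powr 2) b" "encloses UNIV b (\<lambda>x. sqrt (p x))" for b
      proof -
        have "(fst b x)\<^sup>2 \<le> p x \<and> p x \<le> (snd b x)\<^sup>2" for x
        proof -
          have le: "0 \<le> fst b x" "fst b x \<le> sqrt (p x)" "sqrt (p x) \<le> snd b x" "0 \<le> sqrt (p x)"
            using b p0[of x] by (auto simp: Lr_bracket_def encloses_def)
          have "(fst b x)\<^sup>2 \<le> (sqrt (p x))\<^sup>2" "(sqrt (p x))\<^sup>2 \<le> (snd b x)\<^sup>2"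
            using power_mono[OF le(2,1)] power_mono[OF le(3,4)] by blast+
          then show ?thesis using p0[of x] by simp
        qed
        then show ?thesis by (simp add: encloses_def)
      qed
      moreover have "(\<lambda>x. sqrt (p x)) \<in> sqrt_bounded_s_concave_densities M s"
        using p by (auto simp: sqrt_bounded_s_concave_densities_def)
      ultimately show "\<exists>f\<in>sqrt_bounded_s_concave_densities M s. \<forall>b. Lr_bracket 2 UNIV (\<epsilon> powr 2) b \<longrightarrow>
          encloses UNIV b f \<longrightarrow> encloses UNIV (\<lambda>x. (fst b x)\<^sup>2, \<lambda>x. (snd b x)\<^sup>2) p"
        by blast
    qed
    then show "log_enat (hellinger_bracketing_number \<epsilon> (bounded_s_concave_densities M s)) \<le> ereal (K * \<epsilon> powr (- 1 / 2))"
      unfolding hellinger_bracketing_number_def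
      by (rule bracketing_number_le) (auto simp: Q_def G_def)
  qed
qed

end
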